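(* Let $C \subset \mathbb{S}^{47}$ be a spherical code (a finite subset of the unit sphere $\mathbb{S}^{47}\subset\mathbb{R}^{48}$) such that its set of inner products $I(C)=\{\langle x,y\rangle : x,y\in C,\ x\neq y\}$ satisfies \[ I(C) \subset \left[-1,-\tfrac{1}{3}\right] \cup \left[-\tfrac{1}{6},\tfrac{1}{6}\right] \cup \left[\tfrac{1}{3},\tfrac{1}{2}\right], \] and such that $C$ is antipodal or $C$ is a spherical $3$-design. Then $|C| \leq 52\,416\,000$. If equality $|C| = 52\,416\,000$ holds, then $C$ is an antipodal spherical $11$-design, $C$ is distance invariant, and its distance distribution is \[ A_{-1}=1,\quad A_{1/2}=A_{-1/2}=36\,848,\quad A_{1/3}=A_{-1/3}=1\,678\,887,\quad A_{1/6}=A_{-1/6}=12\,608\,784,\quad A_0=23\,766\,960 \] (with $A_t=0$ for all other $t$).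
   Context: A spherical code is a finite set $C\subset\mathbb{S}^{n-1}$; it is antipodal if $C=-C$. For $x\in C$ and $t\in[-1,1)$, $A_t(x)=|\{y\in C: \langle x,y\rangle = t\}|$; $C$ is distance invariant if $A_t(x)$ does not depend on $x\in C$ for every $t$, and then one writes $A_t$. A spherical $\tau$-design is a finite $C\subset\mathbb{S}^{n-1}$ such that $\int_{\mathbb{S}^{n-1}} p\, d\sigma_n = \frac{1}{|C|}\sum_{x\in C} p(x)$ for every polynomial $p$ in $n$ variables of degree at most $\tau$, where $\sigma_n$ is the normalized surface measure on $\mathbb{S}^{n-1}$. *)

theory Defs
  imports "HOL-Analysis.Analysis"
begin

abbreviation unit_sphere :: "(real ^ 'n) set" where
  "unit_sphere \<equiv> sphere 0 1"

definition spherical_code :: "(real ^ 'n) set \<Rightarrow> bool" where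
  "spherical_code C \<longleftrightarrow> finite C \<and> C \<subseteq> unit_sphere"

definition antipodal :: "(real ^ 'n) set \<Rightarrow> bool" where
  "antipodal C \<longleftrightarrow> (\<forall>x\<in>C. - x \<in> C)"

definition inner_products :: "(real ^ 'n) set \<Rightarrow> real set" where
  "inner_products C = {inner x y | x y. x \<in> C \<and> y \<in> C \<and> x \<noteq> y}"

definition poly_fun_deg_le :: "nat \<Rightarrow> (real ^ 'n \<Rightarrow> real) \<Rightarrow> bool" where
  "poly_fun_deg_le d p \<longleftrightarrow>
     (\<exists>c :: ('n \<Rightarrow> nat) \<Rightarrow> real.
        \<forall>x. p x = (\<Sum>\<alpha>\<in>{\<alpha> :: 'n \<Rightarrow> nat. (\<Sum>i\<in>UNIV. \<alpha> i) \<le> d}.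
                        c \<alpha> * (\<Prod>i\<in>UNIV. (x $ i) ^ (\<alpha> i))))"

text \<open>Normalized surface measure on the unit sphere, realised as the cone
  measure: the image of the uniform probability measure on the unit ball under
  radial projection x \<mapsto> x / |x|.\<close>
definition sphere_measure :: "(real ^ 'n) measure" where
  "sphere_measure = distr (uniform_measure lborel (ball 0 1)) borel (\<lambda>x. x /\<^sub>R norm x)"

definition spherical_design :: "(real ^ 'n) set \<Rightarrow> nat \<Rightarrow> bool" where
  "spherical_design C \<tau> \<longleftrightarrow> finite C \<and> C \<subseteq> unit_sphere \<and>
     (\<forall>p. poly_fun_deg_le \<tau> p \<longrightarrow>
        integral\<^sup>L sphere_measure p = (\<Sum>x\<in>C. p x) / real (card C))"

definition dist_count :: "(real ^ 'n) set \<Rightarrow> real \<Rightarrow> real ^ 'n \<Rightarrow> nat" where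
  "dist_count C t x = card {y \<in> C. inner x y = t}"

definition distance_invariant :: "(real ^ 'n) set \<Rightarrow> bool" where
  "distance_invariant C \<longleftrightarrow>
     (\<forall>t. -1 \<le> t \<and> t < 1 \<longrightarrow> (\<forall>x\<in>C. \<forall>y\<in>C. dist_count C t x = dist_count C t y))"

end

theory Submission
  imports Defs "HOL-Probability.Probability_Measure" "HOL-Computational_Algebra.Polynomial"
begin

text \<open>This is Delsarte's linear programming bound. If \<open>P\<^sub>k\<close> is the Gegenbauer polynomial of degree \<open>k\<close>, the
  sums \<open>M\<^sub>k = \<Sum>\<^sub>x\<^sub>,\<^sub>y P\<^sub>k(x \<bullet> y)\<close> are nonnegative, because \<open>P\<^sub>k(x \<bullet> y)\<close> is a positive multiple of the
  integral of \<open>P\<^sub>k(x \<bullet> z) P\<^sub>k(y \<bullet> z)\<close> over the sphere. A polynomial \<open>f\<close> of degree 11 that is nonpositive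
  on the allowed inner products and has nonnegative Gegenbauer coefficients, except for degree 3, where
  \<open>M\<^sub>3 = 0\<close> by hypothesis, gives \<open>|C| \<le> f(1) / f\<^sub>0\<close>. Equality forces all inner products to be roots of \<open>f\<close>
  and all \<open>M\<^sub>k\<close> with \<open>1 \<le> k \<le> 11\<close> to vanish, so that \<open>C\<close> is an 11-design; the moments of the design then
  determine the distance distribution around each point, and the count 1 at inner product -1 is antipodality.\<close>

subsection \<open>Orthogonal invariance of the sphere measure\<close>

text \<open>Spherical harmonics do not appear. Rotation invariance fixes the integral of
  \<open>(x \<bullet> z) ^ i * (y \<bullet> z) ^ j\<close> as a polynomial in
  \<open>x \<bullet> y\<close> up to one factor per total degree, and a correlated pair of normal
  variables has the same moments up to such a factor. So Gaussian integration by parts replaces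
  analysis on the sphere. In the resulting formulas the dimension is a plain number
  \<open>n\<close>, which each integration by parts turns into \<open>n + 2\<close>; differentiating
  a Gegenbauer polynomial shifts the dimension in the same way, so the integral identity behind
  positivity is proved by induction over all dimensions at once. Vanishing sums \<open>M k\<close>
  make a design because the squared quadrature errors of all monomials of one degree add up to an
  expression in a power sum, and power sums and Gegenbauer sums determine each other. The bound is
  (35/9) / (1/13478400) = 52416000. Eight roots of the test polynomial leave eight unknown counts
  per point; the moments of orders 0 to 7 split by parity into two systems of four
  equations.\<close>

lemma distr_lborel_orthogonal:
  fixes T :: "real ^ 'n::{finite,wellorder} \<Rightarrow> real ^ 'n::_"
  assumes T: "orthogonal_transformation T"
  shows "distr lborel borel T = lborel"
proof (rule lborel_eqI[symmetric])
  have lin: "linear T" and bij: "bij T" and invT: "orthogonal_transformation (inv T)"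
    using T by (auto simp: orthogonal_transformation_linear orthogonal_transformation_bij orthogonal_transformation_inv)
  have meas: "T \<in> borel_measurable borel"
    by (intro borel_measurable_continuous_onI linear_continuous_on linear_conv_bounded_linear[THEN iffD1] lin)
  fix l u :: "real ^ 'n::_"
  assume lu: "\<And>b. b \<in> Basis \<Longrightarrow> l \<bullet> b \<le> u \<bullet> b"
  \<comment> \<open>Preimages are what a pushforward measures, while the invariance of Lebesgue
    measure is available for images; the inverse of \<open>T\<close> is orthogonal too.\<close>
  have vim: "T -` box l u = inv T ` box l u"
    by (rule bij_vimage_eq_inv_image[OF bij])
  have B: "T -` box l u \<in> sets borel"
    using measurable_sets[OF meas, of "box l u"] by simp
  have L: "inv T ` box l u \<in> lmeasurable"
    by (rule measurable_orthogonal_image[OF invT]) simp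
  have "emeasure (distr lborel borel T) (box l u) = emeasure lborel (T -` box l u)"
    using meas by (subst emeasure_distr) auto
  also have "\<dots> = emeasure lebesgue (inv T ` box l u)"
    using B by (simp add: vim)
  also have "\<dots> = ennreal (measure lebesgue (inv T ` box l u))"
    using L by (simp add: emeasure_eq_measure2)
  also have "\<dots> = ennreal (measure lebesgue (box l u))"
    by (simp add: measure_orthogonal_image[OF invT])
  also have "\<dots> = (\<Prod>b\<in>Basis. (u - l) \<bullet> b)"
    using lu by (simp add: inner_diff_left)
  finally show "emeasure (distr lborel borel T) (box l u) = (\<Prod>b\<in>Basis. (u - l) \<bullet> b)" .
qed simp

lemma sets_sphere_measure [simp, measurable_cong]: "sets sphere_measure = sets borel"
  by (simp add: sphere_measure_def)

lemma space_sphere_measure [simp]: "space sphere_measure = UNIV"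
  by (simp add: sphere_measure_def)

lemma prob_space_uniform_ball: "prob_space (uniform_measure lborel (ball (0 :: real ^ 'n) 1))"
  by (rule prob_space_uniform_measure) (auto simp: emeasure_lborel_ball_finite less_top[symmetric] emeasure_ball unit_ball_vol_pos[THEN less_imp_neq, symmetric])

interpretation sphere: prob_space "sphere_measure :: (real ^ 'n) measure"
  unfolding sphere_measure_def
  by (intro prob_space.prob_space_distr prob_space_uniform_ball) simp

lemma AE_sphere_measure_norm: "AE z in sphere_measure. norm (z :: real ^ 'n) = 1"
proof -
  \<comment> \<open>The origin is the only point that the radial projection does not send to the
    unit sphere, as \<open>0 /\<^sub>R norm 0 = 0\<close>.\<close>
  have "AE x in lborel. x \<in> ball (0 :: real ^ 'n) 1 \<longrightarrow> x \<noteq> 0"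
    using AE_lborel_singleton[of "0 :: real ^ 'n"] by eventually_elim auto
  hence "AE x in uniform_measure lborel (ball (0 :: real ^ 'n) 1). x \<noteq> 0"
    by (intro AE_uniform_measureI) auto
  hence "AE x in uniform_measure lborel (ball (0 :: real ^ 'n) 1). norm (x /\<^sub>R norm x) = 1"
    by eventually_elim simp
  thus ?thesis
    unfolding sphere_measure_def by (subst AE_distr_iff) auto
qed

text \<open>\<open>T\<close> preserves the ball and Lebesgue measure, and it commutes with the
  radial projection.\<close>

lemma distr_sphere_measure_orthogonal:
  fixes T :: "real ^ 'n::{finite,wellorder} \<Rightarrow> real ^ 'n::_"
  assumes T: "orthogonal_transformation T"
  shows "distr sphere_measure borel T = sphere_measure"
proof -
  have lin: "linear T"
    using T by (rule orthogonal_transformation_linear)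
  have [measurable]: "T \<in> borel_measurable borel"
    by (intro borel_measurable_continuous_onI linear_continuous_on linear_conv_bounded_linear[THEN iffD1] lin)
  let ?U = "uniform_measure lborel (ball (0 :: real ^ 'n::_) 1)"
  have "distr ?U borel T = ?U"
  proof (rule measure_eqI)
    fix A assume "A \<in> sets (distr ?U borel T)"
    hence A [measurable]: "A \<in> sets borel" by simp
    have TA: "T -` A \<in> sets borel"
      using measurable_sets[of T borel borel A] by simp
    have ball: "ball 0 1 \<inter> T -` A = T -` (ball 0 1 \<inter> A)"
      by (auto simp: orthogonal_transformation_norm[OF T])
    have "emeasure lborel (T -` (ball 0 1 \<inter> A)) = emeasure (distr lborel borel T) (ball 0 1 \<inter> A)"
      by (subst emeasure_distr) auto
    also have "\<dots> = emeasure lborel (ball 0 1 \<inter> A)"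
      by (simp add: distr_lborel_orthogonal[OF T])
    finally show "emeasure (distr ?U borel T) A = emeasure ?U A"
      using TA by (simp add: emeasure_distr ball)
  qed simp
  note U = this
  let ?p = "\<lambda>x :: real ^ 'n::_. x /\<^sub>R norm x"
  have "T \<circ> ?p = ?p \<circ> T"
    by (simp add: fun_eq_iff orthogonal_transformation_norm[OF T] linear_scale[OF lin])
  hence "distr (distr ?U borel ?p) borel T = distr (distr ?U borel T) borel ?p"
    by (simp add: distr_distr)
  thus ?thesis
    by (simp only: U sphere_measure_def)
qed

lemma integral_sphere_orthogonal:
  fixes T :: "real ^ 'n::{finite,wellorder} \<Rightarrow> real ^ 'n::_" and f :: "real ^ 'n::_ \<Rightarrow> real"
  assumes T: "orthogonal_transformation T" and [measurable]: "f \<in> borel_measurable borel"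
  shows "(\<integral>z. f (T z) \<partial>sphere_measure) = (\<integral>z. f z \<partial>sphere_measure)"
proof -
  have [measurable]: "T \<in> borel_measurable borel"
    using orthogonal_transformation_linear[OF T]
    by (intro borel_measurable_continuous_onI linear_continuous_on linear_conv_bounded_linear[THEN iffD1])
  have "(\<integral>z. f z \<partial>sphere_measure) = (\<integral>z. f z \<partial>distr sphere_measure borel T)"
    by (simp add: distr_sphere_measure_orthogonal[OF T])
  also have "\<dots> = (\<integral>z. f (T z) \<partial>sphere_measure)"
    by (rule integral_distr) auto
  finally show ?thesis ..
qed

text \<open>The measure is carried by the compact unit sphere, where \<open>f\<close> is bounded,
  however fast \<open>f\<close> grows elsewhere.\<close>

lemma integrable_sphere_continuous:
  fixes f :: "real ^ 'n \<Rightarrow> real"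
  assumes f: "continuous_on UNIV f"
  shows "integrable sphere_measure f"
proof -
  have "bounded (f ` sphere 0 1)"
    by (intro compact_imp_bounded compact_continuous_image continuous_on_subset[OF f]) auto
  then obtain B where B: "\<And>z. norm z = 1 \<Longrightarrow> norm (f z) \<le> B"
    unfolding bounded_iff by force
  show ?thesis
  proof (rule sphere.integrable_const_bound)
    show "AE z in sphere_measure. norm (f z) \<le> B"
      using AE_sphere_measure_norm by eventually_elim (rule B)
    show "f \<in> borel_measurable sphere_measure"
      using borel_measurable_continuous_onI[OF f] by simp
  qed
qed

subsection \<open>Moments of the sphere measure\<close>

lemma integrable_sphere_inner [simp]:
  fixes x y :: "real ^ 'n"
  shows "integrable sphere_measure (\<lambda>z. (x \<bullet> z) ^ i * (y \<bullet> z) ^ j)"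
    and "integrable sphere_measure (\<lambda>z. (x \<bullet> z) ^ i)"
  by (auto intro!: integrable_sphere_continuous continuous_intros)

text \<open>The coordinate \<open>undefined\<close> is an arbitrary choice; by rotation invariance
  every unit direction has the same moments.\<close>

definition axial_moment :: "'n::finite itself \<Rightarrow> nat \<Rightarrow> real" where
  "axial_moment _ k = (\<integral>z. (z $ undefined) ^ k \<partial>(sphere_measure :: (real ^ 'n) measure))"

lemma integral_sphere_inner_power:
  fixes x :: "real ^ 'n::{finite,wellorder}"
  shows "(\<integral>z. (x \<bullet> z) ^ k \<partial>sphere_measure) = axial_moment TYPE('n) k * norm x ^ k"
proof -
  define e :: "real ^ 'n::_" where "e = norm x *\<^sub>R axis undefined 1"
  have "norm e = norm x" by (simp add: e_def)
  then obtain T where T: "orthogonal_transformation T" "T e = x"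
    using orthogonal_transformation_exists by metis
  have "(\<integral>z. (x \<bullet> z) ^ k \<partial>sphere_measure) = (\<integral>z. (x \<bullet> T z) ^ k \<partial>sphere_measure)"
    using integral_sphere_orthogonal[OF T(1), of "\<lambda>z. (x \<bullet> z) ^ k"] by simp
  also have "\<dots> = (\<integral>z. (e \<bullet> z) ^ k \<partial>sphere_measure)"
    using T by (metis orthogonal_transformation_def)
  also have "\<dots> = axial_moment TYPE('n) k * norm x ^ k"
    by (simp add: e_def axial_moment_def inner_axis' power_mult_distrib mult.commute)
  finally show ?thesis .
qed

lemma integral_sphere_odd:
  fixes x y :: "real ^ 'n::{finite,wellorder}"
  assumes "odd (i + j)"
  shows "(\<integral>z. (x \<bullet> z) ^ i * (y \<bullet> z) ^ j \<partial>sphere_measure) = 0"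
proof -
  have "orthogonal_transformation (uminus :: real ^ 'n::_ \<Rightarrow> _)"
    by (simp add: orthogonal_transformation_def linear_iff)
  from integral_sphere_orthogonal[OF this, of "\<lambda>z. (x \<bullet> z) ^ i * (y \<bullet> z) ^ j"]
  have "(\<integral>z. (x \<bullet> z) ^ i * (y \<bullet> z) ^ j \<partial>sphere_measure)
      = (\<integral>z. - ((x \<bullet> z) ^ i * (y \<bullet> z) ^ j) \<partial>sphere_measure)"
    using assms by (auto simp: power_minus')
  thus ?thesis by simp
qed

text \<open>Moments \<open>E(X\<^sup>i Y\<^sup>j)\<close> of standard normal variables \<open>X\<close>, \<open>Y\<close> with covariance \<open>u\<close>,
  computed by Gaussian integration by parts. For \<open>i = 0\<close> or \<open>j = 0\<close> the truncated
  subtraction is harmless because of the vanishing factor.\<close>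

fun gaussian_moment :: "nat \<Rightarrow> nat \<Rightarrow> real \<Rightarrow> real" where
  "gaussian_moment 0 0 u = 1"
| "gaussian_moment 0 (Suc j) u = real j * gaussian_moment 0 (j - 1) u"
| "gaussian_moment (Suc i) j u = real i * gaussian_moment (i - 1) j u + real j * u * gaussian_moment i (j - 1) u"

text \<open>Integration by parts in \<open>Y\<close> instead of \<open>X\<close>. The recursion
  favours the first exponent, so this symmetry is obtained by expanding at \<open>i\<close> and
  comparing with smaller first exponents.\<close>

lemma gaussian_moment_Suc_right:
  "gaussian_moment i (Suc j) u = real j * gaussian_moment i (j - 1) u + real i * u * gaussian_moment (i - 1) j u"
proof (induction i arbitrary: j rule: less_induct)
  case (less i)
  show ?case
  proof (cases i)
    case (Suc m)
    \<comment> \<open>The factors \<open>real j\<close> and \<open>real m\<close> in these three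
      equations make them hold also at 0, where \<open>j - 1\<close> and \<open>m - 1\<close> are
      truncated.\<close>
    have low: "real j * gaussian_moment m j u
        = real j * (real (j - 1) * gaussian_moment m (j - 2) u + real m * u * gaussian_moment (m - 1) (j - 1) u)"
      using less.IH[of m "j - 1"] Suc by (cases j) (simp_all add: numeral_2_eq_2)
    have left: "real m * gaussian_moment m j u
        = real m * (real (m - 1) * gaussian_moment (m - 2) j u + real j * u * gaussian_moment (m - 1) (j - 1) u)"
      by (cases m) (simp_all add: numeral_2_eq_2)
    have up: "real m * gaussian_moment (m - 1) (Suc j) u
        = real m * (real j * gaussian_moment (m - 1) (j - 1) u + real (m - 1) * u * gaussian_moment (m - 2) j u)"
      using less.IH[of "m - 1" j] Suc by (cases m) (simp_all add: numeral_2_eq_2)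
    have "gaussian_moment i (Suc j) u = real m * gaussian_moment (m - 1) (Suc j) u + real (Suc j) * u * gaussian_moment m j u"
      by (simp add: Suc)
    moreover have "gaussian_moment i (j - 1) u
        = real m * gaussian_moment (m - 1) (j - 1) u + real (j - 1) * u * gaussian_moment m (j - 2) u"
      by (simp add: Suc numeral_2_eq_2)
    moreover have "gaussian_moment (i - 1) j u = gaussian_moment m j u"
      by (simp add: Suc)
    ultimately show ?thesis
      using low left up unfolding Suc by (simp add: algebra_simps) algebra
  qed simp
qed

lemma gaussian_moment_odd: "odd (i + j) \<Longrightarrow> gaussian_moment i j u = 0"
proof (induction i j u rule: gaussian_moment.induct)
  case (2 j u)
  then show ?case by (cases j) auto
next
  case (3 i j u)
  then show ?case by (cases i; cases j) auto
qed simp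

text \<open>For Z = X + t Y this is the one-variable rule E(Z^(k+1)) = k Var(Z) E(Z^(k-1)), written
  out binomially.\<close>

lemma gaussian_moment_binomial:
  "(\<Sum>j\<le>Suc k. real (Suc k choose j) * gaussian_moment (Suc k - j) j u * t ^ j)
     = real k * (1 + 2 * u * t + t\<^sup>2) * (\<Sum>j\<le>k - 1. real (k - 1 choose j) * gaussian_moment (k - 1 - j) j u * t ^ j)"
proof (cases k)
  case (Suc l)
  define G where "G i j = gaussian_moment i j u" for i j
  let ?S = "\<Sum>j\<le>l. real (l choose j) * G (l - j) j * t ^ j"
  have c1: "real (k choose j) * real (k - j) = real k * real (l choose j)" for j
    using binomial_absorb_comp[of k j] unfolding of_nat_mult[symmetric] by (simp add: Suc mult.commute)
  have c2: "real (k choose Suc j) * real (Suc j) = real k * real (l choose j)" for j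
    unfolding of_nat_mult[symmetric] by (simp only: Suc Suc_times_binomial_eq)
  have lo: "(\<Sum>j\<le>k. real (k choose j) * real (k - j) * G (k - j - 1) j * t ^ j) = real k * ?S"
    unfolding c1 by (simp add: Suc sum_distrib_left mult_ac)
  have hi: "(\<Sum>j\<le>k. real (k choose j) * real j * G (k - j) (j - 1) * t ^ j) = real k * t * ?S"
  proof -
    have "(\<Sum>j\<le>k. real (k choose j) * real j * G (k - j) (j - 1) * t ^ j)
        = (\<Sum>j\<le>l. (real (k choose Suc j) * real (Suc j)) * G (k - Suc j) j * t ^ Suc j)"
      unfolding Suc by (subst sum.atMost_Suc_shift) simp
    also have "\<dots> = real k * t * ?S"
      unfolding c2 by (simp add: Suc sum_distrib_left mult_ac)
    finally show ?thesis .
  qed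
  \<comment> \<open>Pascal's rule separates E(X Z^k) from t E(Y Z^k).\<close>
  have "(\<Sum>j\<le>Suc k. real (Suc k choose j) * G (Suc k - j) j * t ^ j)
      = (\<Sum>j\<le>k. real (k choose j) * (G (Suc k - j) j * t ^ j)) + (\<Sum>j\<le>k. real (k choose j) * (G (k - j) (Suc j) * t ^ Suc j))"
  proof -
    have "(\<Sum>j\<le>Suc k. real (Suc k choose j) * G (Suc k - j) j * t ^ j)
        = G (Suc k) 0 + (\<Sum>j\<le>k. real (k choose Suc j) * (G (k - j) (Suc j) * t ^ Suc j))
          + (\<Sum>j\<le>k. real (k choose j) * (G (k - j) (Suc j) * t ^ Suc j))"
      by (subst sum.atMost_Suc_shift) (simp add: sum.distrib algebra_simps)
    also have "G (Suc k) 0 + (\<Sum>j\<le>k. real (k choose Suc j) * (G (k - j) (Suc j) * t ^ Suc j))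
        = (\<Sum>j\<le>Suc k. real (k choose j) * (G (Suc k - j) j * t ^ j))"
      by (subst sum.atMost_Suc_shift) simp
    finally show ?thesis by simp
  qed
  \<comment> \<open>The sums come from differentiating Z^k in X and in Y; the factors are the
    covariances of Z with X and with Y.\<close>
  also have "\<dots> = (\<Sum>j\<le>k. real (k choose j) * real (k - j) * G (k - j - 1) j * t ^ j) * (1 + u * t)
      + (\<Sum>j\<le>k. real (k choose j) * real j * G (k - j) (j - 1) * t ^ j) * (u + t)"
    unfolding sum.distrib[symmetric] sum_distrib_right
  proof (rule sum.cong[OF refl])
    fix j assume "j \<in> {..k}"
    hence "G (Suc k - j) j = real (k - j) * G (k - j - 1) j + real j * u * G (k - j) (j - 1)"
      by (simp add: G_def Suc_diff_le)
    moreover have "G (k - j) (Suc j) = real j * G (k - j) (j - 1) + real (k - j) * u * G (k - j - 1) j"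
      unfolding G_def by (rule gaussian_moment_Suc_right)
    ultimately show "real (k choose j) * (G (Suc k - j) j * t ^ j) + real (k choose j) * (G (k - j) (Suc j) * t ^ Suc j)
        = real (k choose j) * real (k - j) * G (k - j - 1) j * t ^ j * (1 + u * t)
          + real (k choose j) * real j * G (k - j) (j - 1) * t ^ j * (u + t)"
      by (simp only:) (simp add: algebra_simps)
  qed
  also have "\<dots> = real k * (1 + 2 * u * t + t\<^sup>2) * ?S"
    unfolding lo hi by (simp add: algebra_simps power2_eq_square)
  finally show ?thesis
    by (simp add: G_def Suc)
qed simp

text \<open>\<open>E(X + t Y)\<^sup>2\<^sup>N\<close>, where \<open>X + t Y\<close> has variance \<open>1 + 2ut + t\<^sup>2\<close>.\<close>

lemma gaussian_moment_generating:
  "(\<Sum>j\<le>2 * N. real (2 * N choose j) * gaussian_moment (2 * N - j) j u * t ^ j)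
     = gaussian_moment (2 * N) 0 u * (1 + 2 * u * t + t\<^sup>2) ^ N"
proof (induction N)
  case (Suc N)
  have "(\<Sum>j\<le>2 * Suc N. real (2 * Suc N choose j) * gaussian_moment (2 * Suc N - j) j u * t ^ j)
      = real (2 * N + 1) * (1 + 2 * u * t + t\<^sup>2) * (\<Sum>j\<le>2 * N. real (2 * N choose j) * gaussian_moment (2 * N - j) j u * t ^ j)"
    using gaussian_moment_binomial[of "2 * N + 1" u t] by simp
  thus ?case by (simp add: Suc.IH)
qed simp

text \<open>The value is the double factorial (2N-1)!!, whatever \<open>u\<close> is.\<close>

lemma gaussian_moment_pos: "gaussian_moment (2 * N) 0 u > 0"
  by (induction N) (auto intro!: mult_pos_pos)

text \<open>Polarization: by rotation invariance the integral of \<open>((x + t y) \<bullet> z) ^ (2 N)\<close> is a multiple of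
  \<open>norm (x + t y) ^ (2 N)\<close>; compare the coefficients of the powers of \<open>t\<close>.\<close>

lemma integral_sphere_mixed_aux:
  fixes x y :: "real ^ 'n::{finite,wellorder}"
  assumes x: "norm x = 1" and y: "norm y = 1" and ij: "i + j = 2 * N"
  shows "gaussian_moment (2 * N) 0 (x \<bullet> y) * (\<integral>z. (x \<bullet> z) ^ i * (y \<bullet> z) ^ j \<partial>sphere_measure)
       = axial_moment TYPE('n) (2 * N) * gaussian_moment i j (x \<bullet> y)"
proof -
  let ?c = "axial_moment TYPE('n) (2 * N)"
  let ?g = "gaussian_moment (2 * N) 0 (x \<bullet> y)"
  define I where "I j = (\<integral>z. (x \<bullet> z) ^ (2 * N - j) * (y \<bullet> z) ^ j \<partial>sphere_measure)" for j
  have "(\<Sum>j\<le>2*N. (?g * (real (2 * N choose j) * I j)) * t ^ j)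
      = (\<Sum>j\<le>2*N. (?c * (real (2 * N choose j) * gaussian_moment (2 * N - j) j (x \<bullet> y))) * t ^ j)" for t
  proof -
    have nrm: "norm (x + t *\<^sub>R y) ^ 2 = 1 + 2 * (x \<bullet> y) * t + t ^ 2"
      using x y unfolding power2_norm_eq_inner
      by (simp add: inner_add_left inner_add_right norm_eq_1 inner_commute power2_eq_square algebra_simps)
    have "(\<Sum>j\<le>2*N. real (2 * N choose j) * I j * t ^ j)
        = (\<Sum>j\<le>2*N. \<integral>z. real (2 * N choose j) * t ^ j * ((x \<bullet> z) ^ (2 * N - j) * (y \<bullet> z) ^ j) \<partial>sphere_measure)"
      by (simp add: I_def) (simp add: mult_ac)
    also have "\<dots> = (\<integral>z. (\<Sum>j\<le>2*N. real (2 * N choose j) * t ^ j * ((x \<bullet> z) ^ (2 * N - j) * (y \<bullet> z) ^ j)) \<partial>sphere_measure)"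
      by (subst Bochner_Integration.integral_sum) auto
    also have "\<dots> = (\<integral>z. ((x + t *\<^sub>R y) \<bullet> z) ^ (2 * N) \<partial>sphere_measure)"
      by (intro Bochner_Integration.integral_cong refl, subst add.commute)
         (simp only: inner_add_left inner_scaleR_left binomial_ring power_mult_distrib, simp add: mult_ac)
    also have "\<dots> = ?c * (norm (x + t *\<^sub>R y) ^ 2) ^ N"
      by (simp only: power_mult[symmetric] integral_sphere_inner_power)
    finally have "(\<Sum>j\<le>2*N. real (2 * N choose j) * I j * t ^ j) = ?c * (1 + 2 * (x \<bullet> y) * t + t\<^sup>2) ^ N"
      unfolding nrm .
    hence "?g * (\<Sum>j\<le>2*N. real (2 * N choose j) * I j * t ^ j)
        = ?c * (\<Sum>j\<le>2*N. real (2 * N choose j) * gaussian_moment (2 * N - j) j (x \<bullet> y) * t ^ j)"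
      unfolding gaussian_moment_generating by simp
    thus ?thesis by (simp only: sum_distrib_left mult.assoc)
  qed
  hence "\<forall>j\<le>2*N. ?g * (real (2 * N choose j) * I j) = ?c * (real (2 * N choose j) * gaussian_moment (2 * N - j) j (x \<bullet> y))"
    unfolding polyfun_eq_coeffs[symmetric] by (rule allI)
  hence "?g * (real (2 * N choose j) * I j) = ?c * (real (2 * N choose j) * gaussian_moment (2 * N - j) j (x \<bullet> y))"
    using ij by simp
  moreover have "2 * N - j = i" using ij by simp
  moreover have "real (2 * N choose j) \<noteq> 0" using ij by simp
  ultimately show ?thesis by (simp add: I_def)
qed

lemma sum_sphere_coordinates:
  fixes x :: "real ^ 'n"
  shows "(\<Sum>b\<in>UNIV. (axis b 1 \<bullet> x)\<^sup>2) = (norm x)\<^sup>2"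
  by (simp add: inner_axis' power2_norm_eq_inner) (simp add: inner_vec_def power2_eq_square)

text \<open>The coordinates of \<open>z\<close> satisfy \<open>\<Sum>\<^sub>b z\<^sub>b\<^sup>2 = 1\<close> almost everywhere, which relates the moments of
  orders \<open>2 N\<close> and \<open>2 N + 2\<close>.\<close>

lemma axial_moment_eq:
  "axial_moment TYPE('n::{finite,wellorder}) (2 * N) * (\<Prod>s<N. real (CARD('n) + 2 * s)) = gaussian_moment (2 * N) 0 u"
proof (induction N)
  case 0
  then show ?case by (simp add: axial_moment_def sphere.prob_space[simplified])
next
  case (Suc N)
  let ?k = "2 * N"
  define x :: "real ^ 'n::_" where "x = axis undefined 1"
  have x: "norm x = 1" by (simp add: x_def)
  have ax: "norm (axis b 1 :: real ^ 'n::_) = 1" for b by simp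
  define g where "g = gaussian_moment (2 * Suc N) 0 u"
  have indep: "gaussian_moment (2 * M) 0 v = gaussian_moment (2 * M) 0 u" for M v
    by (induction M) auto
  have "axial_moment TYPE('n) ?k = (\<integral>z. (x \<bullet> z) ^ ?k \<partial>sphere_measure)"
    by (simp add: integral_sphere_inner_power x)
  also have "\<dots> = (\<integral>z. (\<Sum>b\<in>UNIV. (x \<bullet> z) ^ ?k * (axis b 1 \<bullet> z)\<^sup>2) \<partial>sphere_measure)"
    by (rule integral_cong_AE)
       (use AE_sphere_measure_norm in \<open>auto simp: sum_distrib_left[symmetric] sum_sphere_coordinates
          elim!: eventually_mono\<close>)
  also have "\<dots> = (\<Sum>b\<in>UNIV. \<integral>z. (x \<bullet> z) ^ ?k * (axis b 1 \<bullet> z)\<^sup>2 \<partial>sphere_measure)"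
    by (rule Bochner_Integration.integral_sum) simp
  finally have "g * axial_moment TYPE('n) ?k
     = (\<Sum>b\<in>UNIV. g * (\<integral>z. (x \<bullet> z) ^ ?k * (axis b 1 \<bullet> z)\<^sup>2 \<partial>sphere_measure))"
    by (simp only: sum_distrib_left)
  also have "\<dots> = (\<Sum>b\<in>UNIV. gaussian_moment (2 * Suc N) 0 (x \<bullet> axis b 1) * (\<integral>z. (x \<bullet> z) ^ ?k * (axis b 1 \<bullet> z)\<^sup>2 \<partial>sphere_measure))"
    unfolding g_def by (intro sum.cong refl arg_cong2[where f = "(*)"] indep[symmetric])
  also have "\<dots> = (\<Sum>b\<in>UNIV. axial_moment TYPE('n) (2 * Suc N) * gaussian_moment ?k 2 (x \<bullet> axis b 1))"
    by (intro sum.cong refl integral_sphere_mixed_aux x ax) simp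
  also have "\<dots> = axial_moment TYPE('n) (2 * Suc N) * (\<Sum>b\<in>UNIV. gaussian_moment ?k 0 u + real ?k * (axis b 1 \<bullet> x)\<^sup>2 * gaussian_moment ?k 0 u)"
  proof -
    \<comment> \<open>Two integrations by parts, and (2N-1) E(X^(2N-2)) = E(X^(2N)). Summed over the
      coordinates of the unit vector \<open>x\<close>, this yields the new factor
      \<open>CARD('n) + 2 * N\<close>.\<close>
    have "gaussian_moment ?k 2 v = gaussian_moment ?k 0 u + real ?k * v\<^sup>2 * gaussian_moment ?k 0 u" for v
    proof (cases N)
      case (Suc M)
      thus ?thesis using indep[of M v]
        by (simp add: numeral_2_eq_2 gaussian_moment_Suc_right power2_eq_square del: gaussian_moment.simps(3))
          (simp add: indep[of M v] algebra_simps)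
    qed (simp add: numeral_2_eq_2)
    thus ?thesis by (simp add: sum_distrib_left inner_commute)
  qed
  also have "\<dots> = axial_moment TYPE('n) (2 * Suc N) * real (CARD('n) + 2 * N) * gaussian_moment ?k 0 u"
    by (simp add: sum.distrib sum_distrib_left[symmetric] sum_distrib_right[symmetric] sum_sphere_coordinates x algebra_simps)
  also have "gaussian_moment ?k 0 u = axial_moment TYPE('n) ?k * (\<Prod>s<N. real (CARD('n) + 2 * s))"
    by (rule Suc.IH[symmetric])
  finally have "axial_moment TYPE('n) ?k * (axial_moment TYPE('n) (2 * Suc N) * (\<Prod>s<Suc N. real (CARD('n) + 2 * s)))
      = axial_moment TYPE('n) ?k * g"
    by (auto simp: mult_ac)
  moreover have "axial_moment TYPE('n) ?k \<noteq> 0"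
    using Suc.IH gaussian_moment_pos[of N u] by auto
  ultimately have "axial_moment TYPE('n) (2 * Suc N) * (\<Prod>s<Suc N. real (CARD('n) + 2 * s)) = g"
    by (rule mult_left_cancel[THEN iffD1, rotated])
  thus ?case by (simp only: g_def)
qed

lemma axial_moment_odd:
  assumes "odd k"
  shows "axial_moment TYPE('n::{finite,wellorder}) k = 0"
proof -
  have "axial_moment TYPE('n) k = (\<integral>z. (axis undefined 1 \<bullet> z) ^ k * (axis undefined 1 \<bullet> z) ^ 0 \<partial>(sphere_measure :: (real ^ 'n::_) measure))"
    by (simp add: integral_sphere_inner_power)
  also have "\<dots> = 0"
    using assms by (intro integral_sphere_odd) simp
  finally show ?thesis .
qed

text \<open>A standard Gaussian vector in dimension n is a uniform direction times an independent
  radius R, and the denominator is E(R^(i+j)) for even i + j. For odd i + j the numerator vanishes,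
  so the rounding is harmless. The dimension is a number and not a type, so that inductions can
  change it.\<close>

definition mixed_moment :: "nat \<Rightarrow> nat \<Rightarrow> nat \<Rightarrow> real \<Rightarrow> real" where
  "mixed_moment n i j u = gaussian_moment i j u / (\<Prod>s<(i + j) div 2. real (n + 2 * s))"

lemma integral_sphere_mixed:
  fixes x y :: "real ^ 'n::{finite,wellorder}"
  assumes "norm x = 1" and "norm y = 1"
  shows "(\<integral>z. (x \<bullet> z) ^ i * (y \<bullet> z) ^ j \<partial>sphere_measure) = mixed_moment CARD('n) i j (x \<bullet> y)"
proof (cases "odd (i + j)")
  case True
  thus ?thesis by (simp add: integral_sphere_odd mixed_moment_def gaussian_moment_odd)
next
  case False
  then obtain N where N: "i + j = 2 * N" by blast
  let ?D = "\<Prod>s<N. real (CARD('n) + 2 * s)"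
  let ?I = "\<integral>z. (x \<bullet> z) ^ i * (y \<bullet> z) ^ j \<partial>sphere_measure"
  let ?a = "axial_moment TYPE('n) (2 * N)"
  have "?a * ?D \<noteq> 0"
    unfolding axial_moment_eq[where 'n='n, of N 0] using gaussian_moment_pos[of N 0] by simp
  hence nz: "?a \<noteq> 0" "?D \<noteq> 0"
    by (auto simp only: mult_eq_0_iff)
  have "?a * (?I * ?D) = ?a * ?D * ?I" by (simp only: mult_ac)
  also have "\<dots> = ?a * gaussian_moment i j (x \<bullet> y)"
    unfolding axial_moment_eq[where u = "x \<bullet> y"] by (rule integral_sphere_mixed_aux[OF assms N])
  finally have "?I * ?D = gaussian_moment i j (x \<bullet> y)"
    by (rule mult_left_cancel[OF nz(1), THEN iffD1])
  hence "?I = gaussian_moment i j (x \<bullet> y) / ?D"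
    by (rule nonzero_eq_divide_eq[OF nz(2), THEN iffD2])
  moreover have "(i + j) div 2 = N" using N by simp
  ultimately show ?thesis
    by (simp only: mixed_moment_def)
qed

subsection \<open>Gegenbauer polynomials\<close>

text \<open>Monic Gegenbauer polynomials for dimension \<open>n\<close>, by a recursion that raises the dimension; it is
  compatible with \<open>mixed_moment_Suc_left\<close>, where dimension \<open>n\<close> reduces to dimension \<open>n + 2\<close>.\<close>

fun gegenbauer :: "nat \<Rightarrow> nat \<Rightarrow> real poly" where
  "gegenbauer n 0 = 1"
| "gegenbauer n (Suc 0) = [:0, 1:]"
| "gegenbauer n (Suc (Suc k)) =
     pCons 0 (gegenbauer (n + 2) (Suc k)) - smult (real (k + 1) / real (n + 2 * k)) (gegenbauer (n + 2) k)"

lemma degree_gegenbauer_le: "degree (gegenbauer n k) \<le> k"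
proof (induction n k rule: gegenbauer.induct)
  case (3 n k)
  then show ?case
    by (auto intro!: degree_diff_le order.trans[OF degree_smult_le] simp: degree_pCons_eq_if)
qed simp_all

lemma coeff_gegenbauer_top: "coeff (gegenbauer n k) k = 1"
proof (induction n k rule: gegenbauer.induct)
  case (3 n k)
  have "coeff (gegenbauer (n + 2) k) (Suc (Suc k)) = 0"
    by (intro coeff_eq_0 le_less_trans[OF degree_gegenbauer_le]) simp
  then show ?case using 3 by simp
qed simp_all

lemma real_poly_ext:
  fixes p q :: "real poly"
  assumes "\<And>t. poly p t = poly q t"
  shows "p = q"
  using assms by (simp add: poly_eq_poly_eq_iff[symmetric] fun_eq_iff)

text \<open>Differentiating the recursion leaves one copy of \<open>gegenbauer (n + 2) k\<close>; by
  induction the remaining terms form the recursion of the same polynomial, \<open>k\<close>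
  times.\<close>

lemma pderiv_gegenbauer: "pderiv (gegenbauer n (Suc k)) = smult (real (Suc k)) (gegenbauer (n + 2) k)"
proof (induction k arbitrary: n rule: less_induct)
  case (less k)
  consider "k = 0" | "k = 1" | m where "k = Suc (Suc m)"
    by (metis One_nat_def not0_implies_Suc)
  then show ?case
  proof cases
    case 3
    have 1: "pderiv (gegenbauer (n + 2) (Suc (Suc m))) = smult (real (Suc (Suc m))) (gegenbauer (n + 4) (Suc m))"
      using less.IH[of "Suc m" "n + 2"] 3 by (simp add: numeral_eq_Suc)
    have 2: "pderiv (gegenbauer (n + 2) (Suc m)) = smult (real (Suc m)) (gegenbauer (n + 4) m)"
      using less.IH[of m "n + 2"] 3 by (simp add: numeral_eq_Suc)
    have 4: "gegenbauer (n + 2) (Suc (Suc m)) =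
       pCons 0 (gegenbauer (n + 4) (Suc m)) - smult (real (m + 1) / real (n + 2 * Suc m)) (gegenbauer (n + 4) m)"
      by (simp add: numeral_eq_Suc)
    have 5: "pderiv (gegenbauer n (Suc k)) = gegenbauer (n + 2) k + pCons 0 (pderiv (gegenbauer (n + 2) (Suc (Suc m))))
        - smult (real (Suc (Suc m)) / real (n + 2 * Suc m)) (pderiv (gegenbauer (n + 2) (Suc m)))"
      unfolding 3 gegenbauer.simps(3)[of n "Suc m"] by (simp add: pderiv_diff pderiv_smult pderiv_pCons del: gegenbauer.simps)
    define c where "c = real (m + 1) / real (n + 2 * Suc m)"
    define d where "d = real (Suc (Suc m)) / real (n + 2 * Suc m)"
    have cd: "d * real (Suc m) = c * real (Suc (Suc m))" by (simp add: c_def d_def)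
    have "poly (pderiv (gegenbauer n (Suc k))) t = poly (smult (real (Suc k)) (gegenbauer (n + 2) k)) t" for t
      unfolding 5 1 2 unfolding 3 4 c_def[symmetric] d_def[symmetric] using cd
      by (simp del: gegenbauer.simps) (simp add: algebra_simps del: gegenbauer.simps)
    thus ?thesis by (rule real_poly_ext)
  qed (simp_all add: pderiv_pCons pderiv_diff pderiv_smult one_pCons)
qed

text \<open>The monic form of the classical relation (k + a) C_k^a = a (C_k^(a+1) - C_(k-2)^(a+1)),
  where C_k^a has parameter a = n/2 - 1. It rewrites a polynomial for dimension \<open>n\<close>
  when the integral has moved to dimension \<open>n + 2\<close>.\<close>

lemma gegenbauer_dimension_shift:
  assumes "n > 0"
  shows "gegenbauer n (Suc (Suc k)) = gegenbauer (n + 2) (Suc (Suc k))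
     - smult (real (k + 2) * real (k + 1) / (real (n + 2 * k) * real (n + 2 * k + 2))) (gegenbauer (n + 2) k)"
  using assms
proof (induction k arbitrary: n rule: less_induct)
  case (less k)
  have n: "real n > 0" using less.prems by simp
  consider "k = 0" | "k = 1" | m where "k = Suc (Suc m)"
    by (metis One_nat_def not0_implies_Suc)
  then show ?case
  proof cases
    case 3
    let ?d = "real n + 2 * real k"
    have km: "real k = real m + 2" "real (Suc m) = real k - 1" using 3 by simp_all
    have pos: "?d > 0" "?d + 2 > 0" "?d - 2 > 0" using n km by simp_all
    define e1 where "e1 = (real k + 1) * real k / (?d * (?d + 2))"
    define e2 where "e2 = real k * (real k - 1) / ((?d - 2) * ?d)"
    define c where "c = (real k - 1) / (?d - 2)"
    define c0 where "c0 = (real k + 1) / ?d"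
    define c1 where "c1 = (real k + 1) / (?d + 2)"
    define e where "e = (real k + 2) * (real k + 1) / (?d * (?d + 2))"
    have e: "e = e1 + c0 - c1"
      unfolding e_def e1_def c0_def c1_def using pos by (simp add: divide_simps) (simp add: algebra_simps)
    have ec: "e1 * c = c1 * e2"
      unfolding e1_def e2_def c1_def c_def by (simp add: mult_ac)
    have P: "gegenbauer (n + 2) (Suc k) = gegenbauer (n + 4) (Suc k) - smult e1 (gegenbauer (n + 4) (Suc m))"
      using less.IH[of "Suc m" "n + 2"] 3 by (simp add: e1_def numeral_eq_Suc add_ac del: gegenbauer.simps)
    have Q: "gegenbauer (n + 2) k = gegenbauer (n + 4) k - smult e2 (gegenbauer (n + 4) m)"
      using less.IH[of m "n + 2"] 3 by (simp add: e2_def numeral_eq_Suc add_ac del: gegenbauer.simps)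
    have W: "gegenbauer (n + 2) k = pCons 0 (gegenbauer (n + 4) (Suc m)) - smult c (gegenbauer (n + 4) m)"
      using 3 by (simp add: c_def numeral_eq_Suc add_ac)
    have "gegenbauer n (Suc (Suc k)) = pCons 0 (gegenbauer (n + 2) (Suc k)) - smult c0 (gegenbauer (n + 2) k)"
      by (simp add: c0_def add_ac)
    moreover have "gegenbauer (n + 2) (Suc (Suc k)) = pCons 0 (gegenbauer (n + 4) (Suc k)) - smult c1 (gegenbauer (n + 4) k)"
      by (simp add: c1_def numeral_eq_Suc add_ac)
    \<comment> \<open>Here \<open>w\<close> is \<open>gegenbauer (n + 2) k\<close>, expanded both by
      the induction hypothesis and by the recursion; \<open>ec\<close> cancels the term in
      \<open>s\<close>.\<close>
    moreover have "t * (p - e1 * r) - c0 * w = t * p - c1 * q - (e1 + c0 - c1) * w"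
      if "w = q - e2 * s" "w = t * r - c * s" for t p q r s w :: real
      using that ec by algebra
    from this[OF arg_cong[OF Q, of "\<lambda>p. poly p _", unfolded poly_diff poly_smult]
        arg_cong[OF W, of "\<lambda>p. poly p _", unfolded poly_diff poly_smult poly_pCons add_0_left]]
    have "t * (p - e1 * poly (gegenbauer (n + 4) (Suc m)) t) - c0 * poly (gegenbauer (n + 2) k) t
        = t * p - c1 * poly (gegenbauer (n + 4) k) t - (e1 + c0 - c1) * poly (gegenbauer (n + 2) k) t" for t p .
    ultimately have "poly (gegenbauer n (Suc (Suc k))) t = poly (gegenbauer (n + 2) (Suc (Suc k)) - smult e (gegenbauer (n + 2) k)) t" for t
      by (simp only: P e poly_diff poly_smult poly_pCons add_0_left)
    hence "gegenbauer n (Suc (Suc k)) = gegenbauer (n + 2) (Suc (Suc k)) - smult e (gegenbauer (n + 2) k)"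
      by (rule real_poly_ext)
    thus ?thesis by (simp add: e_def add_ac del: gegenbauer.simps)
  qed (use n in \<open>simp_all add: one_pCons divide_simps\<close>)
qed

section \<open>Orthogonality of Gegenbauer polynomials, in terms of moments\<close>

lemma poly_altdef_le:
  fixes p :: "'a::comm_semiring_1 poly"
  assumes "degree p \<le> d"
  shows "poly p t = (\<Sum>i\<le>d. coeff p i * t ^ i)"
  unfolding poly_altdef using assms
  by (intro sum.mono_neutral_left) (auto simp: coeff_eq_0)

text \<open>Stands for the integral of \<open>(x \<bullet> z) ^ i * poly q (y \<bullet> z)\<close>
  over the sphere in dimension \<open>n\<close>, for unit vectors with
  \<open>x \<bullet> y = u\<close>.\<close>

definition poly_moment :: "nat \<Rightarrow> nat \<Rightarrow> real poly \<Rightarrow> real \<Rightarrow> real" where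
  "poly_moment n i q u = (\<Sum>j\<le>degree q. coeff q j * mixed_moment n i j u)"

lemma poly_moment_altdef:
  assumes "degree q \<le> d"
  shows "poly_moment n i q u = (\<Sum>j\<le>d. coeff q j * mixed_moment n i j u)"
  unfolding poly_moment_def using assms
  by (intro sum.mono_neutral_left) (auto simp: coeff_eq_0)

lemma poly_moment_diff: "poly_moment n i (p - q) u = poly_moment n i p u - poly_moment n i q u"
proof -
  let ?d = "max (degree p) (degree q)"
  show ?thesis
    by (subst (1 2 3) poly_moment_altdef[where d = ?d])
       (auto intro: degree_diff_le simp: sum_subtractf[symmetric] algebra_simps)
qed

lemma poly_moment_smult: "poly_moment n i (smult c q) u = c * poly_moment n i q u"
  by (subst (1 2) poly_moment_altdef[where d = "degree q"])
     (auto simp: sum_distrib_left mult_ac degree_smult_le)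

text \<open>Integration by parts lowers the total degree by 2; removing the factor n from n (n+2)
  (n+4) ... leaves the denominator for dimension n + 2.\<close>

lemma mixed_moment_Suc_left:
  assumes "n > 0"
  shows "mixed_moment n (Suc i) j u
       = (real i * mixed_moment (n + 2) (i - 1) j u + real j * u * mixed_moment (n + 2) i (j - 1) u) / real n"
proof -
  have D: "(\<Prod>s<Suc M. real (n + 2 * s)) = real n * (\<Prod>s<M. real (n + 2 + 2 * s))" for M
    by (subst prod.lessThan_Suc_shift) (simp add: algebra_simps)
  show ?thesis
  proof (cases "i + j = 0")
    case False
    define M where "M = (i + j - 1) div 2"
    have "Suc i + j = Suc (Suc (i + j - 1))" using False by simp
    hence M: "(Suc i + j) div 2 = Suc M" by (simp only: M_def div2_Suc_Suc)
    \<comment> \<open>At \<open>i = 0\<close> the truncated subtraction may give a different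
      product, but the factor \<open>real i\<close> vanishes; \<open>r\<close> treats
      \<open>j = 0\<close> likewise.\<close>
    have l: "real i * x / (\<Prod>s<(i - 1 + j) div 2. real (n + 2 + 2 * s)) = real i * x / (\<Prod>s<M. real (n + 2 + 2 * s))" for x
      by (cases i) (simp_all add: M_def)
    have r: "real j * x / (\<Prod>s<(i + (j - 1)) div 2. real (n + 2 + 2 * s)) = real j * x / (\<Prod>s<M. real (n + 2 + 2 * s))" for x
      by (cases j) (simp_all add: M_def)
    let ?D = "\<Prod>s<M. real (n + 2 + 2 * s)"
    have "real i * mixed_moment (n + 2) (i - 1) j u = real i * gaussian_moment (i - 1) j u / ?D"
      unfolding mixed_moment_def times_divide_eq_right by (rule l)
    moreover have "real j * u * mixed_moment (n + 2) i (j - 1) u = real j * (u * gaussian_moment i (j - 1) u) / ?D"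
      unfolding mixed_moment_def times_divide_eq_right mult.assoc by (rule r)
    moreover have "mixed_moment n (Suc i) j u
        = (real i * gaussian_moment (i - 1) j u + real j * (u * gaussian_moment i (j - 1) u)) / (?D * real n)"
      unfolding mixed_moment_def M D gaussian_moment.simps by (simp only: mult_ac)
    ultimately show ?thesis
      by (simp only: add_divide_distrib[symmetric] divide_divide_eq_left)
  qed (simp add: mixed_moment_def)
qed

lemma mixed_moment_0_Suc:
  assumes "n > 0"
  shows "mixed_moment n 0 (Suc j) u = real j * mixed_moment (n + 2) 0 (j - 1) u / real n"
proof (cases j)
  case (Suc l)
  have "(0 + Suc j) div 2 = Suc (l div 2)" using Suc by simp
  hence "(\<Prod>s<(0 + Suc j) div 2. real (n + 2 * s)) = real n * (\<Prod>s<l div 2. real (n + 2 + 2 * s))"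
    by (simp only: prod.lessThan_Suc_shift) (simp add: algebra_simps)
  moreover have "0 + (j - 1) = l" using Suc by simp
  ultimately show ?thesis by (simp only: mixed_moment_def gaussian_moment.simps) simp
qed (simp add: mixed_moment_def)

lemma poly_moment_pderiv_altdef:
  "poly_moment n i (pderiv q) u = (\<Sum>j\<le>degree q. coeff q j * (real j * mixed_moment n i (j - 1) u))"
proof -
  have "poly_moment n i (pderiv q) u = (\<Sum>j\<le>degree q. coeff (pderiv q) j * mixed_moment n i j u)"
    by (rule poly_moment_altdef) (simp add: degree_pderiv)
  also have "\<dots> = (\<Sum>j\<le>Suc (degree q). coeff q j * (real j * mixed_moment n i (j - 1) u))"
    by (subst sum.atMost_Suc_shift) (simp add: coeff_pderiv mult_ac)
  finally show ?thesis by (simp add: coeff_eq_0)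
qed

lemma poly_moment_Suc_left:
  assumes "n > 0"
  shows "poly_moment n (Suc i) q u = (real i * poly_moment (n + 2) (i - 1) q u + u * poly_moment (n + 2) i (pderiv q) u) / real n"
  unfolding poly_moment_pderiv_altdef unfolding poly_moment_def mixed_moment_Suc_left[OF assms]
  by (simp add: sum_distrib_left sum.distrib[symmetric] sum_divide_distrib algebra_simps)

lemma poly_moment_0_pCons:
  assumes "n > 0"
  shows "poly_moment n 0 (pCons 0 q) u = poly_moment (n + 2) 0 (pderiv q) u / real n"
proof -
  have "poly_moment n 0 (pCons 0 q) u = (\<Sum>j\<le>Suc (degree q). coeff (pCons 0 q) j * mixed_moment n 0 j u)"
    by (rule poly_moment_altdef) (simp add: degree_pCons_eq_if)
  also have "\<dots> = (\<Sum>j\<le>degree q. coeff q j * mixed_moment n 0 (Suc j) u)"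
    by (subst sum.atMost_Suc_shift) simp
  also have "\<dots> = poly_moment (n + 2) 0 (pderiv q) u / real n"
    unfolding poly_moment_pderiv_altdef mixed_moment_0_Suc[OF assms] by (simp add: sum_divide_distrib)
  finally show ?thesis .
qed

text \<open>The constant in \<open>integral_gegenbauer_mult\<close>; the squared L2 norm of the
  polynomial on the sphere is this times its value at 1.\<close>

definition gegenbauer_norm :: "nat \<Rightarrow> nat \<Rightarrow> real" where
  "gegenbauer_norm n k = fact k / (\<Prod>s<k. real (n + 2 * s))"

lemma gegenbauer_norm_0 [simp]: "gegenbauer_norm n 0 = 1"
  by (simp add: gegenbauer_norm_def)

lemma gegenbauer_norm_Suc: "gegenbauer_norm n (Suc k) = real (Suc k) / real (n + 2 * k) * gegenbauer_norm n k"
  by (simp add: gegenbauer_norm_def)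

lemma gegenbauer_norm_Suc_shift: "gegenbauer_norm n (Suc k) = real (Suc k) / real n * gegenbauer_norm (n + 2) k"
  unfolding gegenbauer_norm_def by (subst prod.lessThan_Suc_shift) (simp add: add_ac)

lemma gegenbauer_norm_pos: "n > 0 \<Longrightarrow> gegenbauer_norm n k > 0"
  by (auto simp: gegenbauer_norm_def intro!: divide_pos_pos prod_pos)

lemma mixed_moment_0_0 [simp]: "mixed_moment n 0 0 u = 1"
  by (simp add: mixed_moment_def)

lemma poly_moment_1: "poly_moment n 0 1 u = 1"
  by (simp add: poly_moment_def)

text \<open>The second part is carried along because the recursion for dimension \<open>n\<close>
  consists of polynomials for dimension \<open>n + 2\<close>, still integrated in dimension
  \<open>n\<close>. The first part comes from a cancellation by \<open>ratio\<close>, the second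
  then from the dimension shift.\<close>

lemma poly_moment_0_gegenbauer:
  assumes "n > 0"
  shows "poly_moment n 0 (gegenbauer n k) u = (if k = 0 then 1 else 0)
       \<and> poly_moment n 0 (gegenbauer (n + 2) k) u = (if even k then gegenbauer_norm n k else 0)"
  using assms
proof (induction k arbitrary: n rule: less_induct)
  case (less k)
  have X: "poly_moment n 0 [:0, 1:] u = 0" for n
    by (simp add: poly_moment_def mixed_moment_def)
  consider "k = 0" | "k = 1" | m where "k = Suc (Suc m)"
    by (metis One_nat_def not0_implies_Suc)
  then show ?case
  proof cases
    case 3
    have n: "real n > 0" "real (n + 2 * m) > 0" using less.prems by simp_all
    have pd: "poly_moment (n + 2) 0 (pderiv (gegenbauer (n + 2) (Suc m))) u
        = real (m + 1) * (if even m then gegenbauer_norm (n + 2) m else 0)"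
      using less.IH[of m "n + 2"] 3 by (simp add: pderiv_gegenbauer poly_moment_smult)
    have low: "poly_moment n 0 (gegenbauer (n + 2) m) u = (if even m then gegenbauer_norm n m else 0)"
      using less.IH[of m n] less.prems 3 by simp
    have ratio: "gegenbauer_norm (n + 2) m / real n = gegenbauer_norm n m / real (n + 2 * m)"
    proof -
      have "real (Suc m) * (gegenbauer_norm (n + 2) m / real n) = real (Suc m) * (gegenbauer_norm n m / real (n + 2 * m))"
        using trans[OF gegenbauer_norm_Suc_shift[of n m, symmetric] gegenbauer_norm_Suc[of n m]]
        by (simp only: times_divide_eq_left times_divide_eq_right)
      thus ?thesis by (simp only: mult_left_cancel of_nat_eq_0_iff nat.distinct simp_thms)
    qed
    have a: "poly_moment n 0 (gegenbauer n k) u = 0"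
      unfolding 3 gegenbauer.simps(3) poly_moment_diff poly_moment_smult poly_moment_0_pCons[OF less.prems] pd low
      using arg_cong[OF ratio, of "\<lambda>r. real (m + 1) * r"] by (cases "even m") simp_all
    have "poly_moment n 0 (gegenbauer (n + 2) k) u = real (m + 2) * real (m + 1) / (real (n + 2 * m) * real (n + 2 * m + 2))
        * (if even m then gegenbauer_norm n m else 0)"
      using a unfolding 3 gegenbauer_dimension_shift[OF less.prems] poly_moment_diff poly_moment_smult low
      by (simp del: gegenbauer.simps)
    also have "\<dots> = (if even k then gegenbauer_norm n k else 0)"
      using 3 by (simp add: gegenbauer_norm_Suc mult_ac)
    finally show ?thesis using a 3 by simp
  qed (simp_all add: poly_moment_1 X)
qed

text \<open>One factor \<open>x \<bullet> z\<close> is integrated by parts, leading to smaller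
  \<open>i\<close> in dimension \<open>n + 2\<close>. The derivative of the polynomial already
  belongs to that dimension (\<open>B\<close>); the polynomial itself is moved there by the
  dimension shift (\<open>A\<close>).\<close>

lemma poly_moment_gegenbauer:
  assumes "n > 0"
  shows "(i < k \<longrightarrow> poly_moment n i (gegenbauer n k) u = 0)
       \<and> poly_moment n i (gegenbauer n i) u = gegenbauer_norm n i * poly (gegenbauer n i) u"
  using assms
proof (induction i arbitrary: n k rule: less_induct)
  case (less i)
  have n: "real n > 0" using less.prems by simp
  show ?case
  proof (cases i)
    case 0
    then show ?thesis using poly_moment_0_gegenbauer[OF less.prems] by (auto simp: poly_moment_1)
  next
    case (Suc m)
    have IH: "poly_moment (n + 2) j (gegenbauer (n + 2) l) u
         = (if j = l then gegenbauer_norm (n + 2) l * poly (gegenbauer (n + 2) l) u else 0)"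
      if "j < i" "j \<le> l" for j l
      using less.IH[OF that(1), of "n + 2" l] that(2) by auto
    have main: "poly_moment n i (gegenbauer n (Suc l)) u
        = (if m = l then gegenbauer_norm n i * poly (gegenbauer n i) u else 0)" if ml: "m \<le> l" for l
    proof (cases m)
      case 0
      have "poly_moment n i (gegenbauer n (Suc l)) u = u * (real (Suc l) * (if l = 0 then 1 else 0)) / real n"
        unfolding Suc poly_moment_Suc_left[OF less.prems] pderiv_gegenbauer poly_moment_smult
        using IH[of 0 l] Suc 0 by auto
      thus ?thesis using Suc 0 by (auto simp: gegenbauer_norm_Suc)
    next
      case m: (Suc m')
      then obtain l' where l: "l = Suc l'" using ml m by (cases l) auto
      let ?e = "real (l' + 2) * real (l' + 1) / (real (n + 2 * l') * real (n + 2 * l' + 2))"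
      have A: "poly_moment (n + 2) m' (gegenbauer n (Suc l)) u
          = - ?e * (if m' = l' then gegenbauer_norm (n + 2) l' * poly (gegenbauer (n + 2) l') u else 0)"
        unfolding l gegenbauer_dimension_shift[OF less.prems] poly_moment_diff poly_moment_smult
        using IH[of m' "Suc (Suc l')"] IH[of m' l'] Suc m l ml by (simp del: gegenbauer.simps)
      have B: "poly_moment (n + 2) m (gegenbauer (n + 2) l) u
          = (if m = l then gegenbauer_norm (n + 2) l * poly (gegenbauer (n + 2) l) u else 0)"
        using IH[of m l] Suc ml by simp
      have K: "poly_moment n i (gegenbauer n (Suc l)) u
          = (real m * poly_moment (n + 2) m' (gegenbauer n (Suc l)) u + u * (real (Suc l) * poly_moment (n + 2) m (gegenbauer (n + 2) l) u)) / real n"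
        unfolding Suc poly_moment_Suc_left[OF less.prems] pderiv_gegenbauer poly_moment_smult using m by simp
      \<comment> \<open>On the diagonal both terms survive, and they combine to the two terms of the
        recursion for \<open>gegenbauer n i\<close>.\<close>
      show ?thesis
      proof (cases "m = l")
        case True
        have "m' = l'" using True m l by simp
        have "gegenbauer_norm n i = real (Suc m) / real n * gegenbauer_norm (n + 2) m"
          unfolding Suc by (rule gegenbauer_norm_Suc_shift)
        moreover have "gegenbauer_norm (n + 2) m = real m / real (n + 2 + 2 * m') * gegenbauer_norm (n + 2) m'"
          unfolding m by (rule gegenbauer_norm_Suc)
        moreover have "poly (gegenbauer n i) u = u * poly (gegenbauer (n + 2) m) u
            - real m / real (n + 2 * m') * poly (gegenbauer (n + 2) m') u"
          unfolding Suc m by simp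
        moreover have "real m * (?e * gegenbauer_norm (n + 2) l')
            = real (Suc m) * (real m / real (n + 2 * m')) * (real m / real (n + 2 + 2 * m') * gegenbauer_norm (n + 2) m')"
          using True m l by (simp add: mult_ac)
        moreover have "(a * (- e * (k' * p')) + u * (b * (k * p))) / real n = b / real n * k * (u * p - c * p')"
          if "a * (e * k') = b * c * k" for a b c e k k' p p' :: real
        proof -
          have "a * (- e * (k' * p')) = - (b * c * k * p')"
            using that by algebra
          thus ?thesis
            by (simp only:) (simp add: algebra_simps diff_divide_distrib)
        qed
        ultimately show ?thesis
          unfolding K A B using True \<open>m' = l'\<close> by (simp only: if_True simp_thms)
      next
        case False
        thus ?thesis unfolding K A B using m l by simp
      qed
    qed
    show ?thesis
    proof (intro conjI impI)
      assume "i < k"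
      then obtain l where "k = Suc l" "m < l" using Suc by (cases k) auto
      thus "poly_moment n i (gegenbauer n k) u = 0" using main[of l] by simp
    next
      show "poly_moment n i (gegenbauer n i) u = gegenbauer_norm n i * poly (gegenbauer n i) u"
        using main[of m] Suc by simp
    qed
  qed
qed

lemma integral_gegenbauer_mult:
  fixes x y :: "real ^ 'n::{finite,wellorder}"
  assumes x: "norm x = 1" and y: "norm y = 1"
  shows "(\<integral>z. poly (gegenbauer CARD('n) k) (x \<bullet> z) * poly (gegenbauer CARD('n) k) (y \<bullet> z) \<partial>sphere_measure)
       = gegenbauer_norm CARD('n) k * poly (gegenbauer CARD('n) k) (x \<bullet> y)"
proof -
  let ?n = "CARD('n)"
  let ?p = "gegenbauer ?n k"
  have exp: "poly ?p t = (\<Sum>i\<le>k. coeff ?p i * t ^ i)" for t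
    by (rule poly_altdef_le[OF degree_gegenbauer_le])
  have "(\<integral>z. poly ?p (x \<bullet> z) * poly ?p (y \<bullet> z) \<partial>sphere_measure)
      = (\<integral>z. (\<Sum>i\<le>k. \<Sum>j\<le>k. coeff ?p i * coeff ?p j * ((x \<bullet> z) ^ i * (y \<bullet> z) ^ j)) \<partial>sphere_measure)"
    unfolding exp sum_product by (simp only: mult_ac)
  also have "\<dots> = (\<Sum>i\<le>k. \<Sum>j\<le>k. coeff ?p i * coeff ?p j * mixed_moment ?n i j (x \<bullet> y))"
    by (simp add: Bochner_Integration.integral_sum integral_sphere_mixed[OF x y])
  also have "\<dots> = (\<Sum>i\<le>k. coeff ?p i * poly_moment ?n i ?p (x \<bullet> y))"
    by (simp add: poly_moment_altdef[OF degree_gegenbauer_le] sum_distrib_left mult_ac)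
  \<comment> \<open>Orthogonality to lower powers leaves only the leading power, whose coefficient
    is 1.\<close>
  also have "\<dots> = (\<Sum>i\<in>{k}. coeff ?p i * poly_moment ?n i ?p (x \<bullet> y))"
    using poly_moment_gegenbauer[of ?n _ k "x \<bullet> y"] by (intro sum.mono_neutral_right) auto
  also have "\<dots> = gegenbauer_norm ?n k * poly ?p (x \<bullet> y)"
    using poly_moment_gegenbauer[of ?n k k "x \<bullet> y"] by (simp add: coeff_gegenbauer_top)
  finally show ?thesis .
qed

text \<open>The double sum is a positive multiple of the integral of a square.\<close>

lemma sum_gegenbauer_nonneg:
  fixes C :: "(real ^ 'n::{finite,wellorder}) set"
  assumes "spherical_code C"
  shows "0 \<le> (\<Sum>x\<in>C. \<Sum>y\<in>C. poly (gegenbauer CARD('n) k) (x \<bullet> y))"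
proof -
  let ?n = "CARD('n)"
  let ?p = "poly (gegenbauer ?n k)"
  have C: "finite C" "\<And>x. x \<in> C \<Longrightarrow> norm x = 1"
    using assms by (auto simp: spherical_code_def)
  have int: "integrable sphere_measure (\<lambda>z. ?p (x \<bullet> z) * ?p (y \<bullet> z))" for x y :: "real ^ 'n::_"
    by (intro integrable_sphere_continuous continuous_intros)
  have "0 \<le> (\<integral>z. (\<Sum>x\<in>C. ?p (x \<bullet> z))\<^sup>2 \<partial>sphere_measure)"
    by (rule Bochner_Integration.integral_nonneg) simp
  also have "\<dots> = (\<integral>z. (\<Sum>x\<in>C. \<Sum>y\<in>C. ?p (x \<bullet> z) * ?p (y \<bullet> z)) \<partial>sphere_measure)"
    by (simp only: power2_eq_square sum_product)
  also have "\<dots> = (\<Sum>x\<in>C. \<Sum>y\<in>C. gegenbauer_norm ?n k * ?p (x \<bullet> y))"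
    by (simp add: Bochner_Integration.integral_sum int integral_gegenbauer_mult C)
  also have "\<dots> = gegenbauer_norm ?n k * (\<Sum>x\<in>C. \<Sum>y\<in>C. ?p (x \<bullet> y))"
    by (simp only: sum_distrib_left)
  finally show ?thesis
    using gegenbauer_norm_pos[of ?n k] by (simp add: zero_le_mult_iff)
qed

subsection \<open>Power sums and designs\<close>

text \<open>Words replace exponent vectors, so no multinomial coefficients are needed: a monomial
  occurs once for each ordering of its factors.\<close>

lemma inner_power_words:
  fixes x y :: "real ^ 'n"
  shows "(x \<bullet> y) ^ k = (\<Sum>w\<in>{..<k} \<rightarrow>\<^sub>E UNIV. (\<Prod>j<k. x $ w j) * (\<Prod>j<k. y $ w j))"
proof -
  have "(x \<bullet> y) ^ k = (\<Prod>j<k. \<Sum>i\<in>UNIV. x $ i * y $ i)"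
    by (simp add: inner_vec_def)
  also have "\<dots> = (\<Sum>w\<in>{..<k} \<rightarrow>\<^sub>E UNIV. \<Prod>j<k. x $ w j * y $ w j)"
    by (rule prod_sum_PiE) auto
  finally show ?thesis by (simp add: prod.distrib)
qed

lemma finite_words: "finite ({..<k :: nat} \<rightarrow>\<^sub>E (UNIV :: 'n::finite set))"
  by (intro finite_PiE) auto

lemma integrable_sphere_word [simp]:
  "integrable sphere_measure (\<lambda>z :: real ^ 'n. \<Prod>j<k. z $ w j)"
  by (intro integrable_sphere_continuous continuous_intros)

text \<open>The squared errors of the quadrature, summed over all monomials of degree \<open>k\<close> weighted by their
  multinomial coefficients (i.e. over words of length \<open>k\<close>), add up to \<open>S / N\<^sup>2 - \<mu>\<close>, where \<open>S\<close> is
  the power sum, \<open>N\<close> the cardinality and \<open>\<mu>\<close> the axial moment.\<close>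

lemma word_exact_if_power_sum:
  fixes C :: "(real ^ 'n::{finite,wellorder}) set"
  assumes C: "spherical_code C" and ne: "C \<noteq> {}"
    and S: "(\<Sum>x\<in>C. \<Sum>y\<in>C. (x \<bullet> y) ^ k) = axial_moment TYPE('n) k * (real (card C))\<^sup>2"
    and w: "w \<in> {..<k} \<rightarrow>\<^sub>E UNIV"
  shows "(\<integral>z. (\<Prod>j<k. z $ w j) \<partial>sphere_measure) = (\<Sum>x\<in>C. \<Prod>j<k. x $ w j) / real (card C)"
proof -
  define m where "m w z = (\<Prod>j<k. z $ w j)" for w and z :: "real ^ 'n::_"
  define M where "M w = (\<integral>z. m w z \<partial>sphere_measure)" for w
  define A where "A w = (\<Sum>x\<in>C. m w x) / real (card C)" for w
  let ?W = "{..<k} \<rightarrow>\<^sub>E (UNIV :: 'n set)"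
  let ?\<mu> = "axial_moment TYPE('n) k"
  have finC: "finite C" and unit: "\<And>x. x \<in> C \<Longrightarrow> norm x = 1"
    using C by (auto simp: spherical_code_def)
  have N: "real (card C) > 0" using finC ne by (simp add: card_gt_0_iff)
  have words: "(x \<bullet> y) ^ k = (\<Sum>w\<in>?W. m w x * m w y)" for x y
    unfolding m_def by (rule inner_power_words)
  have intm [simp]: "integrable sphere_measure (m w)" for w
    unfolding m_def by (rule integrable_sphere_word)
  have xM: "(\<Sum>w\<in>?W. m w x * M w) = ?\<mu> * norm x ^ k" for x
  proof -
    have "(\<Sum>w\<in>?W. m w x * M w) = (\<integral>z. (\<Sum>w\<in>?W. m w x * m w z) \<partial>sphere_measure)"
      by (simp add: M_def Bochner_Integration.integral_sum)
    also have "\<dots> = ?\<mu> * norm x ^ k"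
      unfolding words[symmetric] by (rule integral_sphere_inner_power)
    finally show ?thesis .
  qed
  have "(\<Sum>w\<in>?W. M w * M w) = (\<integral>z. (\<Sum>w\<in>?W. m w z * M w) \<partial>sphere_measure)"
    by (simp add: M_def Bochner_Integration.integral_sum)
  also have "\<dots> = (\<integral>z. ?\<mu> \<partial>(sphere_measure :: (real ^ 'n::_) measure))"
    unfolding xM
  proof (rule integral_cong_AE)
    show "AE z in sphere_measure. ?\<mu> * norm (z :: real ^ 'n::_) ^ k = ?\<mu>"
      using AE_sphere_measure_norm by eventually_elim simp
  qed auto
  also have "\<dots> = ?\<mu>"
    using sphere.prob_space[where 'n = 'n] by simp
  finally have MM: "(\<Sum>w\<in>?W. M w * M w) = ?\<mu>" .
  \<comment> \<open>The cross term is the axial moment for every nonempty code; the assumption on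
    power sums enters only through \<open>AA\<close>.\<close>
  have "(\<Sum>w\<in>?W. A w * M w) = (\<Sum>x\<in>C. \<Sum>w\<in>?W. m w x * M w) / real (card C)"
    unfolding A_def sum_divide_distrib sum_distrib_right by (subst sum.swap) simp
  also have "\<dots> = ?\<mu>"
    unfolding xM using N by (simp add: unit)
  finally have AM: "(\<Sum>w\<in>?W. A w * M w) = ?\<mu>" .
  have "(\<Sum>w\<in>?W. A w * A w) = (\<Sum>w\<in>?W. \<Sum>x\<in>C. \<Sum>y\<in>C. m w x * m w y) / (real (card C))\<^sup>2"
    unfolding A_def by (simp add: sum_product power2_eq_square sum_divide_distrib)
  also have "(\<Sum>w\<in>?W. \<Sum>x\<in>C. \<Sum>y\<in>C. m w x * m w y) = (\<Sum>x\<in>C. \<Sum>y\<in>C. (x \<bullet> y) ^ k)"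
    unfolding words by (subst sum.swap, rule sum.cong[OF refl], subst sum.swap, rule refl)
  finally have AA: "(\<Sum>w\<in>?W. A w * A w) = ?\<mu>"
    using N S by simp
  have "(\<Sum>w\<in>?W. (A w - M w)\<^sup>2) = (\<Sum>w\<in>?W. A w * A w - 2 * (A w * M w) + M w * M w)"
    by (simp add: power2_eq_square algebra_simps)
  also have "\<dots> = 0"
    by (simp only: sum.distrib sum_subtractf sum_distrib_left[symmetric] AA AM MM)
  finally have "\<forall>w\<in>?W. (A w - M w)\<^sup>2 = 0"
    by (subst (asm) sum_nonneg_eq_0_iff) (auto simp: finite_words)
  thus ?thesis using w by (simp add: A_def M_def m_def)
qed

lemma monomial_is_word:
  fixes \<alpha> :: "'n::finite \<Rightarrow> nat"
  assumes "(\<Sum>i\<in>UNIV. \<alpha> i) = k"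
  obtains w where "w \<in> {..<k} \<rightarrow>\<^sub>E UNIV"
    and "\<And>z :: real ^ 'n. (\<Prod>i\<in>UNIV. (z $ i) ^ \<alpha> i) = (\<Prod>j<k. z $ w j)"
  using assms
proof (induction k arbitrary: \<alpha> thesis)
  case 0
  then show ?case by (intro 0(1)[of "\<lambda>_. undefined"]) auto
next
  case (Suc k)
  obtain i where i: "\<alpha> i > 0"
    using Suc.prems(2) by (metis gr0I sum.neutral Zero_not_Suc)
  define \<beta> where "\<beta> = \<alpha>(i := \<alpha> i - 1)"
  have "(\<Sum>j\<in>UNIV. \<alpha> j) = \<alpha> i + (\<Sum>j\<in>UNIV - {i}. \<alpha> j)" "(\<Sum>j\<in>UNIV. \<beta> j) = \<beta> i + (\<Sum>j\<in>UNIV - {i}. \<beta> j)"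
    by (rule sum.remove; simp)+
  moreover have "(\<Sum>j\<in>UNIV - {i}. \<beta> j) = (\<Sum>j\<in>UNIV - {i}. \<alpha> j)"
    by (rule sum.cong) (auto simp: \<beta>_def)
  ultimately have "(\<Sum>j\<in>UNIV. \<beta> j) = k"
    using Suc.prems(2) i by (simp add: \<beta>_def)
  then obtain w where w: "w \<in> {..<k} \<rightarrow>\<^sub>E UNIV" "\<And>z :: real ^ 'n. (\<Prod>i\<in>UNIV. (z $ i) ^ \<beta> i) = (\<Prod>j<k. z $ w j)"
    using Suc.IH by metis
  show ?case
  proof (rule Suc.prems(1)[of "w(k := i)"])
    show "w(k := i) \<in> {..<Suc k} \<rightarrow>\<^sub>E UNIV"
      using w(1) by (auto simp: PiE_iff extensional_def)
    fix z :: "real ^ 'n"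
    have "(\<Prod>j\<in>UNIV. (z $ j) ^ \<alpha> j) = (z $ i) ^ \<alpha> i * (\<Prod>j\<in>UNIV - {i}. (z $ j) ^ \<alpha> j)"
      by (rule prod.remove) auto
    also have "(\<Prod>j\<in>UNIV - {i}. (z $ j) ^ \<alpha> j) = (\<Prod>j\<in>UNIV - {i}. (z $ j) ^ \<beta> j)"
      by (rule prod.cong) (auto simp: \<beta>_def)
    also have "(z $ i) ^ \<alpha> i = z $ i * (z $ i) ^ \<beta> i"
      using i by (cases "\<alpha> i") (auto simp: \<beta>_def)
    also have "z $ i * (z $ i) ^ \<beta> i * (\<Prod>j\<in>UNIV - {i}. (z $ j) ^ \<beta> j) = z $ i * (\<Prod>j\<in>UNIV. (z $ j) ^ \<beta> j)"
      by (subst prod.remove[of UNIV i]) auto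
    finally show "(\<Prod>j\<in>UNIV. (z $ j) ^ \<alpha> j) = (\<Prod>j<Suc k. z $ (w(k := i)) j)"
      by (simp add: w(2))
  qed
qed

lemma spherical_design_if_power_sums:
  fixes C :: "(real ^ 'n::{finite,wellorder}) set"
  assumes C: "spherical_code C" and ne: "C \<noteq> {}"
    and S: "\<And>k. k \<le> \<tau> \<Longrightarrow> (\<Sum>x\<in>C. \<Sum>y\<in>C. (x \<bullet> y) ^ k) = axial_moment TYPE('n) k * (real (card C))\<^sup>2"
  shows "spherical_design C \<tau>"
  unfolding spherical_design_def
proof (intro conjI allI impI)
  show "finite C" "C \<subseteq> unit_sphere" using C by (auto simp: spherical_code_def)
  fix p :: "real ^ 'n::_ \<Rightarrow> real" assume "poly_fun_deg_le \<tau> p"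
  define A where "A = {\<alpha> :: 'n \<Rightarrow> nat. (\<Sum>i\<in>UNIV. \<alpha> i) \<le> \<tau>}"
  obtain c where c: "p = (\<lambda>x. \<Sum>\<alpha>\<in>A. c \<alpha> * (\<Prod>i\<in>UNIV. (x $ i) ^ \<alpha> i))"
    using \<open>poly_fun_deg_le \<tau> p\<close> unfolding poly_fun_deg_le_def A_def fun_eq_iff by blast
  have "integral\<^sup>L sphere_measure (\<lambda>x. \<Prod>i\<in>UNIV. (x $ i) ^ \<alpha> i) = (\<Sum>x\<in>C. \<Prod>i\<in>UNIV. (x $ i) ^ \<alpha> i) / real (card C)"
    if \<alpha>: "\<alpha> \<in> A" for \<alpha>
  proof -
    obtain w where w: "w \<in> {..<(\<Sum>i\<in>UNIV. \<alpha> i)} \<rightarrow>\<^sub>E UNIV"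
      "\<And>z :: real ^ 'n::_. (\<Prod>i\<in>UNIV. (z $ i) ^ \<alpha> i) = (\<Prod>j<(\<Sum>i\<in>UNIV. \<alpha> i). z $ w j)"
      using monomial_is_word[OF refl] by blast
    show ?thesis
      unfolding w(2) using \<alpha> by (intro word_exact_if_power_sum C ne S w(1)) (simp add: A_def)
  qed
  note mono = this
  have "integral\<^sup>L sphere_measure p = (\<Sum>\<alpha>\<in>A. c \<alpha> * integral\<^sup>L sphere_measure (\<lambda>x. \<Prod>i\<in>UNIV. (x $ i) ^ \<alpha> i))"
    unfolding c by (subst Bochner_Integration.integral_sum)
      (auto intro!: integrable_mult_right integrable_sphere_continuous continuous_intros)
  also have "\<dots> = (\<Sum>\<alpha>\<in>A. \<Sum>x\<in>C. c \<alpha> * (\<Prod>i\<in>UNIV. (x $ i) ^ \<alpha> i) / real (card C))"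
    by (intro sum.cong refl) (simp add: mono sum_distrib_left sum_divide_distrib)
  also have "\<dots> = (\<Sum>x\<in>C. p x) / real (card C)"
    unfolding c by (subst sum.swap) (simp add: sum_divide_distrib)
  finally show "integral\<^sup>L sphere_measure p = (\<Sum>x\<in>C. p x) / real (card C)" .
qed

lemma poly_fun_inner_power:
  fixes x :: "real ^ 'n"
  assumes "k \<le> \<tau>"
  shows "poly_fun_deg_le \<tau> (\<lambda>y. (x \<bullet> y) ^ k)"
proof -
  define A where "A = {\<alpha> :: 'n \<Rightarrow> nat. (\<Sum>i\<in>UNIV. \<alpha> i) \<le> \<tau>}"
  let ?W = "{..<k} \<rightarrow>\<^sub>E (UNIV :: 'n set)"
  \<comment> \<open>The exponent vector of a word; grouping words by it collects equal monomials in
    \<open>y\<close>.\<close>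
  define \<phi> where "\<phi> w i = card {j\<in>{..<k}. w j = i}" for w :: "nat \<Rightarrow> 'n" and i
  have "A \<subseteq> (UNIV \<rightarrow>\<^sub>E {..\<tau>})"
  proof
    fix \<alpha> assume "\<alpha> \<in> A"
    hence "\<alpha> i \<le> \<tau>" for i
      using member_le_sum[of i UNIV \<alpha>] by (simp add: A_def)
    thus "\<alpha> \<in> (UNIV \<rightarrow>\<^sub>E {..\<tau>})" by (simp add: PiE_iff)
  qed
  hence finA: "finite A" by (rule finite_subset) (intro finite_PiE; simp)
  have \<phi>: "\<phi> w \<in> A" for w
  proof -
    have "(\<Sum>i\<in>UNIV. \<phi> w i) = (\<Sum>i\<in>UNIV. \<Sum>j\<in>{j\<in>{..<k}. w j = i}. 1)"
      by (simp add: \<phi>_def)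
    also have "\<dots> = (\<Sum>j\<in>{..<k}. 1)" by (rule sum.group) auto
    finally show ?thesis using assms by (simp add: A_def)
  qed
  have mon: "(\<Prod>j<k. y $ w j) = (\<Prod>i\<in>UNIV. (y $ i) ^ \<phi> w i)" for w and y :: "real ^ 'n"
  proof -
    have "(\<Prod>i\<in>UNIV. (y $ i) ^ \<phi> w i) = (\<Prod>i\<in>UNIV. \<Prod>j\<in>{j\<in>{..<k}. w j = i}. y $ w j)"
      by (simp add: \<phi>_def)
    also have "\<dots> = (\<Prod>j<k. y $ w j)" by (rule prod.group) auto
    finally show ?thesis ..
  qed
  have "(x \<bullet> y) ^ k = (\<Sum>\<alpha>\<in>A. (\<Sum>w\<in>{w\<in>?W. \<phi> w = \<alpha>}. \<Prod>j<k. x $ w j) * (\<Prod>i\<in>UNIV. (y $ i) ^ \<alpha> i))" for y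
  proof -
    have "(\<Sum>\<alpha>\<in>A. (\<Sum>w\<in>{w\<in>?W. \<phi> w = \<alpha>}. \<Prod>j<k. x $ w j) * (\<Prod>i\<in>UNIV. (y $ i) ^ \<alpha> i))
        = (\<Sum>\<alpha>\<in>A. \<Sum>w\<in>{w\<in>?W. \<phi> w = \<alpha>}. (\<Prod>j<k. x $ w j) * (\<Prod>j<k. y $ w j))"
      unfolding sum_distrib_right by (intro sum.cong refl) (auto simp: mon)
    also have "\<dots> = (\<Sum>w\<in>?W. (\<Prod>j<k. x $ w j) * (\<Prod>j<k. y $ w j))"
      by (rule sum.group) (use finA \<phi> finite_words in auto)
    also have "\<dots> = (x \<bullet> y) ^ k" by (rule inner_power_words[symmetric])
    finally show ?thesis ..
  qed
  thus ?thesis unfolding poly_fun_deg_le_def A_def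
    by (intro exI[of _ "\<lambda>\<alpha>. \<Sum>w\<in>{w\<in>?W. \<phi> w = \<alpha>}. \<Prod>j<k. x $ w j"]) blast
qed

text \<open>The design condition is applied to the power with \<open>x\<close> fixed, so the sum is
  known around every single point. This is what later makes the distances the same from each
  point.\<close>

lemma spherical_design_power_sum:
  fixes C :: "(real ^ 'n::{finite,wellorder}) set"
  assumes "spherical_design C \<tau>" and "k \<le> \<tau>" and "x \<in> C"
  shows "(\<Sum>y\<in>C. (x \<bullet> y) ^ k) = axial_moment TYPE('n) k * real (card C)"
proof -
  have "norm x = 1" "card C > 0" using assms by (auto simp: spherical_design_def card_gt_0_iff)
  moreover have "(\<integral>y. (x \<bullet> y) ^ k \<partial>sphere_measure) = (\<Sum>y\<in>C. (x \<bullet> y) ^ k) / real (card C)"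
    using assms poly_fun_inner_power[of k \<tau> x] unfolding spherical_design_def by blast
  ultimately show ?thesis by (simp add: integral_sphere_inner_power field_simps)
qed

section \<open>Power sums versus Gegenbauer sums\<close>

lemma sum_coeff_gegenbauer_axial_moment:
  assumes "k > 0"
  shows "(\<Sum>i\<le>k. coeff (gegenbauer CARD('n::{finite,wellorder}) k) i * axial_moment TYPE('n) i) = 0"
proof -
  let ?n = "CARD('n)"
  define x :: "real ^ 'n::_" where "x = axis undefined 1"
  have x: "norm x = 1" by (simp add: x_def)
  have "axial_moment TYPE('n) i = mixed_moment ?n 0 i (x \<bullet> x)" for i
    using integral_sphere_mixed[OF x x, of 0 i] integral_sphere_inner_power[of x i] x by simp
  hence "(\<Sum>i\<le>k. coeff (gegenbauer ?n k) i * axial_moment TYPE('n) i) = poly_moment ?n 0 (gegenbauer ?n k) (x \<bullet> x)"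
    by (simp add: poly_moment_altdef[OF degree_gegenbauer_le])
  also have "\<dots> = 0" using poly_moment_0_gegenbauer[of ?n k "x \<bullet> x"] assms by simp
  finally show ?thesis .
qed

lemma sum_gegenbauer_power_sums:
  fixes C :: "'a::real_inner set"
  shows "(\<Sum>x\<in>C. \<Sum>y\<in>C. poly (gegenbauer n k) (x \<bullet> y))
       = (\<Sum>i\<le>k. coeff (gegenbauer n k) i * (\<Sum>x\<in>C. \<Sum>y\<in>C. (x \<bullet> y) ^ i))"
  unfolding poly_altdef_le[OF degree_gegenbauer_le] sum_distrib_left
  by (simp only: sum.swap[where A = C and B = "{..k}"])

lemma sum_gegenbauer_eq_0_if_power_sums:
  fixes C :: "(real ^ 'n::{finite,wellorder}) set"
  assumes "k > 0"
    and "\<And>i. i \<le> k \<Longrightarrow> (\<Sum>x\<in>C. \<Sum>y\<in>C. (x \<bullet> y) ^ i) = axial_moment TYPE('n) i * c"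
  shows "(\<Sum>x\<in>C. \<Sum>y\<in>C. poly (gegenbauer CARD('n) k) (x \<bullet> y)) = 0"
proof -
  have "(\<Sum>x\<in>C. \<Sum>y\<in>C. poly (gegenbauer CARD('n) k) (x \<bullet> y))
      = (\<Sum>i\<le>k. coeff (gegenbauer CARD('n) k) i * axial_moment TYPE('n) i) * c"
    unfolding sum_gegenbauer_power_sums sum_distrib_right by (intro sum.cong refl) (simp add: assms(2))
  thus ?thesis using sum_coeff_gegenbauer_axial_moment[OF assms(1), where 'n = 'n] by simp
qed

text \<open>The system is triangular: the polynomials are monic, so each vanishing sum determines
  the next power sum, and the axial moments satisfy the same relations.\<close>

lemma power_sums_if_sum_gegenbauer_eq_0:
  fixes C :: "(real ^ 'n::{finite,wellorder}) set"
  assumes M: "\<And>k. 0 < k \<Longrightarrow> k \<le> \<tau> \<Longrightarrow> (\<Sum>x\<in>C. \<Sum>y\<in>C. poly (gegenbauer CARD('n) k) (x \<bullet> y)) = 0"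
    and "k \<le> \<tau>"
  shows "(\<Sum>x\<in>C. \<Sum>y\<in>C. (x \<bullet> y) ^ k) = axial_moment TYPE('n) k * (real (card C))\<^sup>2"
  using \<open>k \<le> \<tau>\<close>
proof (induction k rule: less_induct)
  case (less k)
  let ?p = "gegenbauer CARD('n) k"
  let ?S = "\<lambda>i. \<Sum>x\<in>C. \<Sum>y\<in>C. (x \<bullet> y) ^ i"
  let ?\<mu> = "axial_moment TYPE('n)"
  show ?case
  proof (cases "k = 0")
    case True
    thus ?thesis using sphere.prob_space[where 'n='n] by (simp add: axial_moment_def power2_eq_square)
  next
    case False
    have split: "(\<Sum>i\<le>k. coeff ?p i * f i) = f k + (\<Sum>i<k. coeff ?p i * f i)" for f
      by (subst lessThan_Suc_atMost[symmetric]) (simp add: coeff_gegenbauer_top)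
    have "(\<Sum>i\<le>k. coeff ?p i * ?S i) = 0"
      using M[of k] False less.prems unfolding sum_gegenbauer_power_sums by simp
    hence "?S k = - (\<Sum>i<k. coeff ?p i * ?S i)" unfolding split by simp
    also have "\<dots> = - (\<Sum>i<k. coeff ?p i * ?\<mu> i) * (real (card C))\<^sup>2"
      unfolding sum_negf[symmetric] sum_distrib_right using less by (intro sum.cong refl) simp
    also have "- (\<Sum>i<k. coeff ?p i * ?\<mu> i) = ?\<mu> k"
      using sum_coeff_gegenbauer_axial_moment[of k, where 'n = 'n] False unfolding split by simp
    finally show ?thesis .
  qed
qed

lemma antipodal_odd_power_sum:
  fixes C :: "(real ^ 'n) set"
  assumes "antipodal C" and "odd k"
  shows "(\<Sum>x\<in>C. \<Sum>y\<in>C. (x \<bullet> y) ^ k) = 0"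
proof -
  have "(\<Sum>x\<in>C. \<Sum>y\<in>C. (x \<bullet> y) ^ k) = (\<Sum>x\<in>C. \<Sum>y\<in>C. (- x \<bullet> y) ^ k)"
    by (rule sum.reindex_bij_witness[of _ uminus uminus]) (use assms(1) in \<open>auto simp: antipodal_def\<close>)
  also have "\<dots> = - (\<Sum>x\<in>C. \<Sum>y\<in>C. (x \<bullet> y) ^ k)"
    using assms(2) by (simp add: sum_negf)
  finally show ?thesis by simp
qed

subsection \<open>The linear programming bound in dimension 48\<close>

text \<open>Combining the recursion with the dimension shift eliminates dimension \<open>n\<close>.
  The result stays in one dimension, so \<open>n = 46\<close> tabulates the polynomials for
  48.\<close>

lemma gegenbauer_three_term:
  assumes "n > 0"
  shows "gegenbauer (n + 2) (Suc (Suc k)) = pCons 0 (gegenbauer (n + 2) (Suc k))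
     - smult (real ((k + 1) * (n + k)) / real ((n + 2 * k) * (n + 2 * k + 2))) (gegenbauer (n + 2) k)"
proof -
  let ?d = "real (n + 2 * k)"
  define c where "c = real (k + 1) / ?d"
  define e where "e = real (k + 2) * real (k + 1) / (?d * real (n + 2 * k + 2))"
  have d: "?d > 0" using assms by simp
  have ce: "real ((k + 1) * (n + k)) / real ((n + 2 * k) * (n + 2 * k + 2)) = c - e"
  proof -
    have "K * (d - x) / (d * (d + 2)) = K / d - (x + 2) * K / (d * (d + 2))" if "d > 0" for d x K :: real
      using that by (simp add: divide_simps) (simp add: algebra_simps)
    moreover have "real (n + k) = ?d - real k" "real (n + 2 * k + 2) = ?d + 2" "real (k + 2) = real k + 2"
      by simp_all
    ultimately show ?thesis
      using d unfolding c_def e_def of_nat_mult by (simp only:)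
  qed
  have "gegenbauer (n + 2) (Suc (Suc k)) = gegenbauer n (Suc (Suc k)) + smult e (gegenbauer (n + 2) k)"
    unfolding gegenbauer_dimension_shift[OF assms] e_def by (simp del: gegenbauer.simps)
  also have "gegenbauer n (Suc (Suc k)) = pCons 0 (gegenbauer (n + 2) (Suc k)) - smult c (gegenbauer (n + 2) k)"
    by (simp add: c_def)
  finally show ?thesis
    unfolding ce smult_diff_left by simp
qed

lemma gegenbauer_48:
  shows "gegenbauer 48 0 = [:1:]"
    and "gegenbauer 48 1 = [:0, 1:]"
    and "gegenbauer 48 2 = [:-1/48, 0, 1:]"
    and gegenbauer_48_3: "gegenbauer 48 3 = [:0, -3/50, 0, 1:]"
    and "gegenbauer 48 4 = [:3/2600, 0, -3/26, 0, 1:]"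
    and "gegenbauer 48 5 = [:0, 5/936, 0, -5/27, 0, 1:]"
    and "gegenbauer 48 6 = [:-5/52416, 0, 5/336, 0, -15/56, 0, 1:]"
    and "gegenbauer 48 7 = [:0, -5/8352, 0, 15/464, 0, -21/58, 0, 1:]"
    and "gegenbauer 48 8 = [:1/100224, 0, -1/464, 0, 7/116, 0, -7/15, 0, 1:]"
    and "gegenbauer 48 9 = [:0, 9/115072, 0, -21/3596, 0, 63/620, 0, -18/31, 0, 1:]"
    and "gegenbauer 48 10 = [:-9/7364608, 0, 315/920576, 0, -105/7936, 0, 315/1984, 0, -45/64, 0, 1:]"
    and "gegenbauer 48 11 = [:0, -21/1841152, 0, 35/31744, 0, -105/3968, 0, 15/64, 0, -5/6, 0, 1:]"
proof -
  have rec: "gegenbauer 48 (Suc (Suc k)) = pCons 0 (gegenbauer 48 (Suc k))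
     - smult (real ((k + 1) * (46 + k)) / real ((46 + 2 * k) * (46 + 2 * k + 2))) (gegenbauer 48 k)" for k
    using gegenbauer_three_term[of 46 k] by (simp del: gegenbauer.simps)
  show 0: "gegenbauer 48 0 = [:1:]" by (simp add: one_pCons)
  show 1: "gegenbauer 48 1 = [:0, 1:]" by simp
  show 2: "gegenbauer 48 2 = [:-1/48, 0, 1:]"
    using rec[of 0] by (simp add: 0 1[unfolded One_nat_def] numeral_2_eq_2 del: gegenbauer.simps)
  show 3: "gegenbauer 48 3 = [:0, -3/50, 0, 1:]"
    using rec[of 1] unfolding Suc_1 2 1 by (simp add: numeral_3_eq_3 del: gegenbauer.simps)
  show 4: "gegenbauer 48 4 = [:3/2600, 0, -3/26, 0, 1:]"
    using rec[of 2] by (simp add: 2 3 del: gegenbauer.simps)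
  show 5: "gegenbauer 48 5 = [:0, 5/936, 0, -5/27, 0, 1:]"
    using rec[of 3] by (simp add: 3 4 del: gegenbauer.simps)
  show 6: "gegenbauer 48 6 = [:-5/52416, 0, 5/336, 0, -15/56, 0, 1:]"
    using rec[of 4] by (simp add: 4 5 del: gegenbauer.simps)
  show 7: "gegenbauer 48 7 = [:0, -5/8352, 0, 15/464, 0, -21/58, 0, 1:]"
    using rec[of 5] by (simp add: 5 6 del: gegenbauer.simps)
  show 8: "gegenbauer 48 8 = [:1/100224, 0, -1/464, 0, 7/116, 0, -7/15, 0, 1:]"
    using rec[of 6] by (simp add: 6 7 del: gegenbauer.simps)
  show 9: "gegenbauer 48 9 = [:0, 9/115072, 0, -21/3596, 0, 63/620, 0, -18/31, 0, 1:]"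
    using rec[of 7] by (simp add: 7 8 del: gegenbauer.simps)
  show 10: "gegenbauer 48 10 = [:-9/7364608, 0, 315/920576, 0, -105/7936, 0, 315/1984, 0, -45/64, 0, 1:]"
    using rec[of 8] by (simp add: 8 9 del: gegenbauer.simps)
  show 11: "gegenbauer 48 11 = [:0, -21/1841152, 0, 35/31744, 0, -105/3968, 0, 15/64, 0, -5/6, 0, 1:]"
    using rec[of 9] by (simp add: 9 10 del: gegenbauer.simps)
qed

text \<open>It vanishes at \<open>1/2, \<plusminus>1/3, \<plusminus>1/6\<close> with a sign change and at \<open>0, -1/2, -1\<close> doubly. With a simple
  root at \<open>-1\<close> the Gegenbauer coefficient of degree 4 would be negative.
  Degree 3 still has a negative coefficient, which is where the antipodality or 3-design hypothesis enters.\<close>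

definition lp_poly :: "real poly" where
  "lp_poly = [:1, 1:]\<^sup>2 * [:1/2, 1:]\<^sup>2 * [:-1/2, 1:] * [:-1/9, 0, 1:] * [:-1/36, 0, 1:] * [:0, 0, 1:]"

text \<open>Both sides are compared by their explicit coefficients. The constant 1/13478400 is the
  denominator of the bound.\<close>

lemma lp_poly_expansion:
  "lp_poly = [:1/13478400:] + smult (3961/1758931200) (gegenbauer 48 1) + smult (1/183222) (gegenbauer 48 2)
     - smult (2531/16236288) (gegenbauer 48 3) + smult (53/601344) (gegenbauer 48 4)
     + smult (163637/11651040) (gegenbauer 48 5) + smult (41419/401760) (gegenbauer 48 6)
     + smult (71515/160704) (gegenbauer 48 7) + smult (1481/1152) (gegenbauer 48 8)
     + smult (22/9) (gegenbauer 48 9) + smult (5/2) (gegenbauer 48 10) + gegenbauer 48 11"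
  unfolding lp_poly_def gegenbauer_48 by (simp add: power2_eq_square)

lemma poly_lp_poly:
  "poly lp_poly t = ((t + 1) * (t + 1/2) * t)\<^sup>2 * ((t - 1/2) * ((t\<^sup>2 - 1/9) * (t\<^sup>2 - 1/36)))"
proof -
  have "poly [:1, 1:] t = t + 1" "poly [:1/2, 1:] t = t + 1/2" "poly [:-1/2, 1:] t = t - 1/2"
    "poly [:-1/9, 0, 1:] t = t\<^sup>2 - 1/9" "poly [:-1/36, 0, 1:] t = t\<^sup>2 - 1/36" "poly [:0, 0, 1:] t = t\<^sup>2"
    by (simp_all add: power2_eq_square)
  thus ?thesis
    unfolding lp_poly_def poly_mult poly_power power_mult_distrib by (simp only: mult_ac)
qed

text \<open>The product of the two quadratic factors is negative only for 1/6 < \<bar>t\<bar> < 1/3,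
  the gaps excluded by assumption; elsewhere \<open>t - 1/2\<close> decides the sign.\<close>

lemma lp_poly_nonpos:
  assumes "t \<in> {-1..-1/3} \<union> {-1/6..1/6} \<union> {1/3..1/2}"
  shows "poly lp_poly t \<le> 0"
proof -
  have "(t\<^sup>2 - 1/9) * (t\<^sup>2 - 1/36) \<ge> 0"
  proof (cases "\<bar>t\<bar> \<le> 1/6")
    case True
    hence "t\<^sup>2 \<le> (1/6)\<^sup>2" by (metis abs_ge_zero power2_abs power_mono)
    thus ?thesis by (intro mult_nonpos_nonpos) (simp_all add: power2_eq_square)
  next
    case False
    hence "1/3 \<le> \<bar>t\<bar>" using assms by auto
    hence "(1/3)\<^sup>2 \<le> t\<^sup>2" by (metis power2_abs power_mono zero_le_divide_1_iff zero_le_numeral)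
    thus ?thesis by (intro mult_nonneg_nonneg) (simp_all add: power2_eq_square)
  qed
  moreover have "t - 1/2 \<le> 0" using assms by auto
  ultimately show ?thesis
    unfolding poly_lp_poly by (intro mult_nonneg_nonpos mult_nonpos_nonneg) auto
qed

lemma lp_poly_roots:
  "poly lp_poly t = 0 \<longleftrightarrow> t \<in> {-1, -1/2, -1/3, -1/6, 0, 1/6, 1/3, 1/2}"
proof -
  have "t\<^sup>2 - 1/9 = (t - 1/3) * (t + 1/3)" "t\<^sup>2 - 1/36 = (t - 1/6) * (t + 1/6)"
    by (simp_all add: power2_eq_square algebra_simps)
  thus ?thesis unfolding poly_lp_poly by auto
qed

section \<open>Distance counts from moments\<close>

lemma axial_moment_48:
  "axial_moment TYPE(48) 0 = 1" "axial_moment TYPE(48) 2 = 1/48" "axial_moment TYPE(48) 4 = 1/800"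
  "axial_moment TYPE(48) 6 = 1/8320"
  using axial_moment_eq[where 'n = 48, of 0 0] axial_moment_eq[where 'n = 48, of 1 0]
    axial_moment_eq[where 'n = 48, of 2 0] axial_moment_eq[where 'n = 48, of 3 0]
  by (simp_all add: eval_nat_numeral)

text \<open>Moments of orders 1, 3, 5, 7 around a point: \<open>a\<close> is the count at -1, and
  \<open>x\<close>, \<open>y\<close>, \<open>w\<close> are the differences of the counts at
  \<plusminus>1/2, \<plusminus>1/3, \<plusminus>1/6.\<close>

lemma odd_moment_system:
  fixes a x y w :: real
  assumes "x/2 + y/3 + w/6 = a - 1" and "x/8 + y/27 + w/216 = a - 1"
    and "x/32 + y/243 + w/7776 = a - 1" and "x/128 + y/2187 + w/279936 = a - 1"
  shows "a = 1" "x = 0" "y = 0" "w = 0"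
proof -
  have "3 * x + 2 * y + w = 6 * (a - 1)" "27 * x + 8 * y + w = 216 * (a - 1)"
    "243 * x + 32 * y + w = 7776 * (a - 1)" "2187 * x + 128 * y + w = 279936 * (a - 1)"
    using assms by simp_all
  note eqs = this
  have "24 * x + 6 * y = 210 * (a - 1)" "240 * x + 30 * y = 7770 * (a - 1)" "2184 * x + 126 * y = 279930 * (a - 1)"
    using eqs by simp_all
  hence "120 * x = 6720 * (a - 1)" "1680 * x = 275520 * (a - 1)"
    by simp_all
  thus "a = 1" "x = 0" by simp_all
  with eqs show "y = 0" "w = 0" by simp_all
qed

text \<open>Orders 0, 2, 4, 6 with sums of opposite counts, and \<open>z\<close> the count at 0. The
  right sides are 52416000 times 1, 1/48, 1/800, 1/8320, minus 2 for the point itself and its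
  antipode.\<close>

lemma even_moment_system:
  fixes x y w z :: real
  assumes "x + y + w + z = 52415998" and "x/4 + y/9 + w/36 = 1091998"
    and "x/16 + y/81 + w/1296 = 65518" and "x/64 + y/729 + w/46656 = 6298"
  shows "x = 73696" "y = 3357774" "w = 25217568" "z = 23766960"
proof -
  have eqs: "9 * x + 4 * y + w = 39311928" "81 * x + 16 * y + w = 84911328" "729 * x + 64 * y + w = 293839488"
    using assms by simp_all
  hence "72 * x + 12 * y = 45599400" "648 * x + 48 * y = 208928160"
    by simp_all
  thus "x = 73696" by simp
  with \<open>72 * x + 12 * y = 45599400\<close> show "y = 3357774" by simp
  with eqs \<open>x = 73696\<close> show "w = 25217568" by simp
  with assms \<open>x = 73696\<close> \<open>y = 3357774\<close> show "z = 23766960" by simp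
qed

lemma sum_lp_poly_expansion:
  fixes C :: "(real ^ 48) set"
  defines "M k \<equiv> (\<Sum>x\<in>C. \<Sum>y\<in>C. poly (gegenbauer 48 k) (x \<bullet> y))"
  shows "(\<Sum>x\<in>C. \<Sum>y\<in>C. poly lp_poly (x \<bullet> y))
    = 1/13478400 * (real (card C))\<^sup>2 + 3961/1758931200 * M 1 + 1/183222 * M 2
     - 2531/16236288 * M 3 + 53/601344 * M 4 + 163637/11651040 * M 5 + 41419/401760 * M 6
     + 71515/160704 * M 7 + 1481/1152 * M 8 + 22/9 * M 9 + 5/2 * M 10 + M 11"
  unfolding lp_poly_expansion M_def
  by (simp add: sum.distrib sum_subtractf sum_distrib_left power2_eq_square del: gegenbauer.simps)

lemma power_sum_by_dist_count:
  fixes C :: "(real ^ 'n) set"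
  assumes C: "spherical_code C" and x: "x \<in> C" and T: "finite T" "1 \<notin> T"
    and ip: "\<And>y. y \<in> C \<Longrightarrow> y \<noteq> x \<Longrightarrow> x \<bullet> y \<in> T"
  shows "(\<Sum>y\<in>C. (x \<bullet> y) ^ k) = 1 + (\<Sum>t\<in>T. real (dist_count C t x) * t ^ k)"
proof -
  have fin: "finite C" and nx: "norm x = 1" using C x by (auto simp: spherical_code_def)
  have xx: "x \<bullet> x = 1" using nx by (simp add: norm_eq_1)
  have "(\<Sum>y\<in>C. (x \<bullet> y) ^ k) = (\<Sum>t\<in>insert 1 T. \<Sum>y\<in>{y\<in>C. x \<bullet> y = t}. (x \<bullet> y) ^ k)"
    using fin T ip xx by (intro sum.group[symmetric]) auto
  also have "\<dots> = (\<Sum>t\<in>insert 1 T. real (dist_count C t x) * t ^ k)"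
    by (intro sum.cong refl) (simp add: dist_count_def)
  also have "\<dots> = real (dist_count C 1 x) + (\<Sum>t\<in>T. real (dist_count C t x) * t ^ k)"
    using T by simp
  \<comment> \<open>Any other point at inner product 1 would put 1 into \<open>T\<close>.\<close>
  also have "{y\<in>C. x \<bullet> y = 1} = {x}"
    using ip T(2) xx x by auto metis
  hence "dist_count C 1 x = 1" by (simp add: dist_count_def)
  finally show ?thesis by simp
qed

theorem theorem5:
  fixes C :: "(real ^ 48) set"
  assumes "spherical_code C"
    and "inner_products C \<subseteq> {-1..-1/3} \<union> {-1/6..1/6} \<union> {1/3..1/2}"
    and "antipodal C \<or> spherical_design C 3"
  shows "card C \<le> 52416000 \<and>
         (card C = 52416000 \<longrightarrow>
           antipodal C \<and> spherical_design C 11 \<and> distance_invariant C \<and>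
           (\<forall>x\<in>C. \<forall>t. -1 \<le> t \<and> t < 1 \<longrightarrow>
              dist_count C t x =
                (if t = -1 then 1
                 else if t = 1/2 \<or> t = -1/2 then 36848
                 else if t = 1/3 \<or> t = -1/3 then 1678887
                 else if t = 1/6 \<or> t = -1/6 then 12608784
                 else if t = 0 then 23766960
                 else 0)))"
proof -
  define N where "N = real (card C)"
  define M where "M k = (\<Sum>x\<in>C. \<Sum>y\<in>C. poly (gegenbauer 48 k) (x \<bullet> y))" for k
  have finC: "finite C" and unit: "\<And>x. x \<in> C \<Longrightarrow> x \<bullet> x = 1"
    using assms(1) by (auto simp: spherical_code_def norm_eq_1)
  have ip: "x \<bullet> y \<in> {-1..-1/3} \<union> {-1/6..1/6} \<union> {1/3..1/2}" if "x \<in> C" "y \<in> C" "x \<noteq> y" for x y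
    using assms(2) that unfolding inner_products_def by blast
  have M: "M k \<ge> 0" for k
    using sum_gegenbauer_nonneg[OF assms(1), of k] by (simp add: M_def)
  \<comment> \<open>The polynomial of degree 3 is odd, so antipodality cancels its double sum; for a
    3-design its mean over the code is its mean over the sphere, which is 0.\<close>
  have M3: "M 3 = 0"
    using assms(3)
  proof
    assume "antipodal C"
    hence "(\<Sum>x\<in>C. \<Sum>y\<in>C. (x \<bullet> y) ^ 3) = 0" "(\<Sum>x\<in>C. \<Sum>y\<in>C. (x \<bullet> y) ^ 1) = 0"
      by (rule antipodal_odd_power_sum; simp)+
    thus ?thesis
      by (simp add: M_def gegenbauer_48_3 algebra_simps sum_subtractf sum_divide_distrib[symmetric]
          sum_distrib_left[symmetric] sum_distrib_right[symmetric] power3_eq_cube)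
  next
    assume des: "spherical_design C 3"
    have "(\<Sum>x\<in>C. \<Sum>y\<in>C. (x \<bullet> y) ^ i) = axial_moment TYPE(48) i * (N * N)" if "i \<le> 3" for i
      using spherical_design_power_sum[OF des that] by (simp add: N_def)
    from sum_gegenbauer_eq_0_if_power_sums[OF _ this, of 3] show ?thesis
      by (simp add: M_def)
  qed
  \<comment> \<open>The nonnegative slack from the pairs with first point \<open>x\<close>, lost
    when off-diagonal terms are dropped.\<close>
  define P where "P x = (\<Sum>y\<in>C - {x}. - poly lp_poly (x \<bullet> y))" for x
  have off: "- poly lp_poly (x \<bullet> y) \<ge> 0" if "x \<in> C" "y \<in> C - {x}" for x y
    using lp_poly_nonpos[OF ip, of x y] that by auto
  have P: "P x \<ge> 0" if "x \<in> C" for x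
    unfolding P_def using off[OF that] by (rule sum_nonneg)
  have lp1: "poly lp_poly 1 = 35/9"
    by (simp add: poly_lp_poly power2_eq_square)
  have "(\<Sum>y\<in>C. poly lp_poly (x \<bullet> y)) = 35/9 - P x" if "x \<in> C" for x
    by (subst sum.remove[OF finC that]) (simp add: P_def sum_negf unit[OF that] lp1)
  hence "(\<Sum>x\<in>C. \<Sum>y\<in>C. poly lp_poly (x \<bullet> y)) = 35/9 * N - (\<Sum>x\<in>C. P x)"
    by (simp add: sum_subtractf N_def)
  \<comment> \<open>The double sum of \<open>lp_poly\<close>, computed once by splitting off the
    diagonal and once by the Gegenbauer expansion.\<close>
  hence key: "35/9 * N = 1/13478400 * N\<^sup>2 + (\<Sum>x\<in>C. P x) + (3961/1758931200 * M 1 + 1/183222 * M 2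
     + 53/601344 * M 4 + 163637/11651040 * M 5 + 41419/401760 * M 6
     + 71515/160704 * M 7 + 1481/1152 * M 8 + 22/9 * M 9 + 5/2 * M 10 + M 11)"
    using sum_lp_poly_expansion[of C] M3 unfolding M_def[symmetric] N_def[symmetric] by simp
  have SP: "(\<Sum>x\<in>C. P x) \<ge> 0" using P by (rule sum_nonneg)
  have "35/9 * N \<ge> 1/13478400 * N\<^sup>2"
    unfolding key using SP M[of 1] M[of 2] M[of 4] M[of 5] M[of 6] M[of 7] M[of 8] M[of 9] M[of 10] M[of 11]
    by simp
  hence "N * N \<le> 52416000 * N" by (simp add: power2_eq_square)
  moreover have "N \<ge> 0" by (simp add: N_def)
  ultimately have "N \<le> 52416000"
    by (cases "N = 0") (auto simp: mult_le_cancel_right)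
  hence bound: "card C \<le> 52416000" by (simp add: N_def)
  have eq: "antipodal C \<and> spherical_design C 11 \<and> (\<forall>x\<in>C. \<forall>t. t < 1 \<longrightarrow>
              dist_count C t x =
                (if t = -1 then 1
                 else if t = 1/2 \<or> t = -1/2 then 36848
                 else if t = 1/3 \<or> t = -1/3 then 1678887
                 else if t = 1/6 \<or> t = -1/6 then 12608784
                 else if t = 0 then 23766960
                 else 0))"
    if card: "card C = 52416000"
  proof -
    have N: "N = 52416000" using card by (simp add: N_def)
    have ne: "C \<noteq> {}" using card by auto
    \<comment> \<open>At the extremal \<open>N\<close> the linear and quadratic terms of
      \<open>key\<close> cancel, so a sum of nonnegative terms is 0.\<close>
    have zero: "(\<Sum>x\<in>C. P x) + (3961/1758931200 * M 1 + 1/183222 * M 2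
       + 53/601344 * M 4 + 163637/11651040 * M 5 + 41419/401760 * M 6
       + 71515/160704 * M 7 + 1481/1152 * M 8 + 22/9 * M 9 + 5/2 * M 10 + M 11) = 0"
      using key unfolding N by simp
    note nonneg = SP M[of 1] M[of 2] M[of 4] M[of 5] M[of 6] M[of 7] M[of 8] M[of 9] M[of 10] M[of 11]
    have M0: "M 1 = 0" "M 2 = 0" "M 4 = 0" "M 5 = 0" "M 6 = 0" "M 7 = 0" "M 8 = 0" "M 9 = 0" "M 10 = 0" "M 11 = 0"
      and "(\<Sum>x\<in>C. P x) = 0"
      using zero nonneg by linarith+
    hence P0: "P x = 0" if "x \<in> C" for x
      using that finC P by (subst (asm) sum_nonneg_eq_0_iff) auto
    have "poly lp_poly (x \<bullet> y) = 0" if "x \<in> C" "y \<in> C" "y \<noteq> x" for x y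
    proof -
      have "\<forall>y\<in>C - {x}. - poly lp_poly (x \<bullet> y) = 0"
        using P0[OF that(1)] off[OF that(1)] finC unfolding P_def by (subst (asm) sum_nonneg_eq_0_iff) auto
      thus ?thesis using that by auto
    qed
    hence T: "x \<bullet> y \<in> {-1, -1/2, -1/3, -1/6, 0, 1/6, 1/3, 1/2}" if "x \<in> C" "y \<in> C" "y \<noteq> x" for x y
      using that lp_poly_roots by blast
    have M0': "M k = 0" if "0 < k" "k \<le> 11" for k
    proof -
      have "k = 1 \<or> k = 2 \<or> k = 3 \<or> k = 4 \<or> k = 5 \<or> k = 6 \<or> k = 7 \<or> k = 8 \<or> k = 9 \<or> k = 10 \<or> k = 11"
        using that by presburger
      thus ?thesis using M0 M3 by auto
    qed
    have des: "spherical_design C 11"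
    proof (rule spherical_design_if_power_sums[OF assms(1) ne])
      fix k :: nat assume "k \<le> 11"
      show "(\<Sum>x\<in>C. \<Sum>y\<in>C. (x \<bullet> y) ^ k) = axial_moment TYPE(48) k * (real (card C))\<^sup>2"
        using \<open>k \<le> 11\<close> by (rule power_sums_if_sum_gegenbauer_eq_0[rotated]) (use M0' in \<open>simp add: M_def\<close>)
    qed
    have dist: "dist_count C (-1) x = 1 \<and> dist_count C (1/2) x = 36848 \<and> dist_count C (-1/2) x = 36848
        \<and> dist_count C (1/3) x = 1678887 \<and> dist_count C (-1/3) x = 1678887
        \<and> dist_count C (1/6) x = 12608784 \<and> dist_count C (-1/6) x = 12608784 \<and> dist_count C 0 x = 23766960"
      if x: "x \<in> C" for x
    proof -
      define A where "A t = real (dist_count C t x)" for t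
      have "(\<Sum>y\<in>C. (x \<bullet> y) ^ k) = 1 + (\<Sum>t\<in>{-1, -1/2, -1/3, -1/6, 0, 1/6, 1/3, 1/2}. A t * t ^ k)" for k
        unfolding A_def by (rule power_sum_by_dist_count[OF assms(1) x _ _ T[OF x]]) auto
      \<comment> \<open>The leading 1 is the term of \<open>x\<close> itself. Since
        \<open>0 ^ 0 = 1\<close>, the count at 0 enters the equation of order 0 and no
        other.\<close>
      hence eq: "1 + (A (-1) * (-1) ^ k + (A (-1/2) * (-1/2) ^ k + (A (-1/3) * (-1/3) ^ k + (A (-1/6) * (-1/6) ^ k + (A 0 * 0 ^ k
          + (A (1/6) * (1/6) ^ k + (A (1/3) * (1/3) ^ k + A (1/2) * (1/2) ^ k))))))) = axial_moment TYPE(48) k * 52416000"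
        if "k \<le> 11" for k
        using spherical_design_power_sum[OF des that x] by (simp add: card)
      let ?x = "A (1/2) - A (-1/2)" and ?y = "A (1/3) - A (-1/3)" and ?w = "A (1/6) - A (-1/6)"
      have "?x/2 + ?y/3 + ?w/6 = A (-1) - 1" "?x/8 + ?y/27 + ?w/216 = A (-1) - 1"
        "?x/32 + ?y/243 + ?w/7776 = A (-1) - 1" "?x/128 + ?y/2187 + ?w/279936 = A (-1) - 1"
        using eq[of 1] eq[of 3] eq[of 5] eq[of 7]
        by (simp_all add: axial_moment_odd power_divide diff_divide_distrib)
      note o = odd_moment_system[OF this]
      let ?x = "A (1/2) + A (-1/2)" and ?y = "A (1/3) + A (-1/3)" and ?w = "A (1/6) + A (-1/6)"
      have "?x + ?y + ?w + A 0 = 52415998" "?x/4 + ?y/9 + ?w/36 = 1091998"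
        "?x/16 + ?y/81 + ?w/1296 = 65518" "?x/64 + ?y/729 + ?w/46656 = 6298"
        using eq[of 0] eq[of 2] eq[of 4] eq[of 6] o(1)
        by (simp_all add: axial_moment_48 power_divide add_divide_distrib)
      note e = even_moment_system[OF this]
      show ?thesis
        using o e unfolding A_def by simp
    qed
    have "antipodal C"
      unfolding antipodal_def
    proof
      fix x assume x: "x \<in> C"
      have "card {y \<in> C. x \<bullet> y = -1} = 1" using dist[OF x] by (simp add: dist_count_def)
      then obtain y where y: "y \<in> C" "x \<bullet> y = -1"
        by (metis (mono_tags, lifting) card_1_singletonE insertI1 mem_Collect_eq)
      \<comment> \<open>Unit vectors with inner product -1 are opposite.\<close>
      have "(x + y) \<bullet> (x + y) = 0"
        using y unit[OF x] unit[OF y(1)] by (simp add: inner_add_left inner_add_right inner_commute)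
      hence "y = - x" by (simp add: add_eq_0_iff)
      thus "- x \<in> C" using y by simp
    qed
    have outside: "dist_count C t x = 0"
      if "x \<in> C" "t < 1" "t \<notin> {-1, -1/2, -1/3, -1/6, 0, 1/6, 1/3, 1/2}" for x t
    proof -
      have "{y \<in> C. x \<bullet> y = t} = {}" using T[OF that(1)] unit[OF that(1)] that(2,3) by fastforce
      thus ?thesis by (simp only: dist_count_def card.empty)
    qed
    show ?thesis
    proof (intro conjI ballI allI impI)
      fix x t assume x: "x \<in> C" and t: "t < (1 :: real)"
      show "dist_count C t x = (if t = -1 then 1
                 else if t = 1/2 \<or> t = -1/2 then 36848
                 else if t = 1/3 \<or> t = -1/3 then 1678887
                 else if t = 1/6 \<or> t = -1/6 then 12608784
                 else if t = 0 then 23766960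
                 else 0)"
      proof (cases "t \<in> {-1, -1/2, -1/3, -1/6, 0, 1/6, 1/3, 1/2}")
        case True
        thus ?thesis
          by (elim insertE emptyE; hypsubst) (simp_all add: dist[OF x, simplified])
      next
        case False
        thus ?thesis using outside[OF x t] by simp
      qed
    qed fact+
  qed
  show ?thesis
  proof (intro conjI impI bound)
    assume card: "card C = 52416000"
    note eq = eq[OF card]
    show "distance_invariant C" unfolding distance_invariant_def using eq by simp
  qed (use eq in blast)+
qed

end
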